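(* Minimum Diameter Edge Deletion can be solved in $O((\ell-1)^k\, n^2 (n+m))$ time, where $n$ and $m$ are the numbers of vertices and edges of the input graph.
   Context: Minimum Diameter Edge Deletion (MDED): given a connected undirected graph $G=(V,E)$ and integers $k,\ell$, decide whether there is $F\subseteq E$ with $|F|\le k$ such that $G-F$ is connected and has diameter at least $\ell$ (the diameter being the maximum, over distinct vertex pairs, of the shortest-path distance, measured in number of edges).
   Formalization: For ℓ ≤ 1 or k < 0, where (ℓ−1)^k can be zero, negative or fractional and so cannot bound a running time, the factor (ℓ−1)^k is replaced by 1; for ℓ ≥ 2 and k ≥ 0 the bound is as stated. *)

theory Defs
  imports Main
begin

section \<open>Graphs and the decision problem\<close>

definition simple_graph :: "'a set \<Rightarrow> 'a set set \<Rightarrow> bool" where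
  "simple_graph V E \<longleftrightarrow> finite V \<and> (\<forall>e\<in>E. e \<subseteq> V \<and> card e = 2)"

definition is_path :: "'a set \<Rightarrow> 'a set set \<Rightarrow> 'a \<Rightarrow> 'a list \<Rightarrow> 'a \<Rightarrow> bool" where
  "is_path V E u p v \<longleftrightarrow>
     p \<noteq> [] \<and> hd p = u \<and> last p = v \<and> distinct p \<and> set p \<subseteq> V \<and>
     successively (\<lambda>x y. {x, y} \<in> E) p"

definition graph_connected :: "'a set \<Rightarrow> 'a set set \<Rightarrow> bool" where
  "graph_connected V E \<longleftrightarrow> V \<noteq> {} \<and> (\<forall>u\<in>V. \<forall>v\<in>V. \<exists>p. is_path V E u p v)"

text \<open>A path is given by its list of vertices, so its number of edges is one less than the
  length of the list. The distance is only meaningful when some path exists.\<close>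

definition graph_dist :: "'a set \<Rightarrow> 'a set set \<Rightarrow> 'a \<Rightarrow> 'a \<Rightarrow> nat" where
  "graph_dist V E u v = (LEAST d. \<exists>p. is_path V E u p v \<and> length p = d + 1)"

text \<open>The element 0 only matters for a graph with a single vertex, whose diameter is
  thereby 0; distances between distinct vertices are positive.\<close>

definition graph_diameter :: "'a set \<Rightarrow> 'a set set \<Rightarrow> nat" where
  "graph_diameter V E =
     Max (insert 0 {graph_dist V E u v | u v. u \<in> V \<and> v \<in> V \<and> u \<noteq> v})"

definition MDED :: "'a set \<Rightarrow> 'a set set \<Rightarrow> int \<Rightarrow> int \<Rightarrow> bool" where
  "MDED V E k l \<longleftrightarrow>
     (\<exists>F\<subseteq>E. int (card F) \<le> k \<and> graph_connected V (E - F) \<and>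
            int (graph_diameter V (E - F)) \<ge> l)"


section \<open>A random access machine with uniform cost measure\<close>

text \<open>Programs are structured random access machine programs over the integers, with
  addition, subtraction and comparison as the only arithmetic. The memory consists of
  arrays indexed by integers; array names are fixed in the program text, so a program uses
  only finitely many arrays, and these can be interleaved in a single memory with constant
  overhead. A scalar variable is a cell of an array at a constant index.\<close>

type_synonym mem = "nat \<Rightarrow> int \<Rightarrow> int"

datatype aexp =
    Const int
  | Read nat aexp
  | Add aexp aexp
  | Sub aexp aexp

datatype bexp =
    Less aexp aexp
  | Equal aexp aexp
  | Neg bexp
  | Conj bexp bexp

datatype com =
    Skip
  | Write nat aexp aexp
  | Seq com com
  | Cond bexp com com
  | Loop bexp com

primrec aval :: "aexp \<Rightarrow> mem \<Rightarrow> int" where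
  "aval (Const c) M = c"
| "aval (Read a e) M = M a (aval e M)"
| "aval (Add e1 e2) M = aval e1 M + aval e2 M"
| "aval (Sub e1 e2) M = aval e1 M - aval e2 M"

primrec bval :: "bexp \<Rightarrow> mem \<Rightarrow> bool" where
  "bval (Less e1 e2) M \<longleftrightarrow> aval e1 M < aval e2 M"
| "bval (Equal e1 e2) M \<longleftrightarrow> aval e1 M = aval e2 M"
| "bval (Neg b) M \<longleftrightarrow> \<not> bval b M"
| "bval (Conj b1 b2) M \<longleftrightarrow> bval b1 M \<and> bval b2 M"

text \<open>Every constant, memory access, arithmetic operation, comparison and Boolean
  connective is charged one time unit.\<close>

primrec acost :: "aexp \<Rightarrow> nat" where
  "acost (Const c) = 1"
| "acost (Read a e) = acost e + 1"
| "acost (Add e1 e2) = acost e1 + acost e2 + 1"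
| "acost (Sub e1 e2) = acost e1 + acost e2 + 1"

primrec bcost :: "bexp \<Rightarrow> nat" where
  "bcost (Less e1 e2) = acost e1 + acost e2 + 1"
| "bcost (Equal e1 e2) = acost e1 + acost e2 + 1"
| "bcost (Neg b) = bcost b + 1"
| "bcost (Conj b1 b2) = bcost b1 + bcost b2 + 1"

text \<open>\<open>exec c M t M'\<close>: started in memory \<open>M\<close>, the program \<open>c\<close> halts after exactly
  \<open>t\<close> time units in memory \<open>M'\<close>.\<close>

inductive exec :: "com \<Rightarrow> mem \<Rightarrow> nat \<Rightarrow> mem \<Rightarrow> bool" where
  Skip: "exec Skip M 1 M"
| Write: "exec (Write a i e) M (acost i + acost e + 1)
            (M(a := (M a)(aval i M := aval e M)))"
| Seq: "exec c1 M t1 M1 \<Longrightarrow> exec c2 M1 t2 M2 \<Longrightarrow> exec (Seq c1 c2) M (t1 + t2) M2"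
| CondTrue: "bval b M \<Longrightarrow> exec c1 M t M' \<Longrightarrow> exec (Cond b c1 c2) M (bcost b + t + 1) M'"
| CondFalse: "\<not> bval b M \<Longrightarrow> exec c2 M t M' \<Longrightarrow> exec (Cond b c1 c2) M (bcost b + t + 1) M'"
| LoopFalse: "\<not> bval b M \<Longrightarrow> exec (Loop b c) M (bcost b + 1) M"
| LoopTrue: "bval b M \<Longrightarrow> exec c M t1 M1 \<Longrightarrow> exec (Loop b c) M1 t2 M2 \<Longrightarrow>
             exec (Loop b c) M (bcost b + t1 + t2 + 1) M2"

inductive_cases SkipE: "exec Skip M t M'"
inductive_cases WriteE: "exec (Write a i e) M t M'"
inductive_cases SeqE: "exec (Seq c1 c2) M t M'"
inductive_cases CondE: "exec (Cond b c1 c2) M t M'"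
inductive_cases LoopE: "exec (Loop b c) M t M'"

lemma exec_deterministic:
  "exec c M t M' \<Longrightarrow> exec c M s N \<Longrightarrow> t = s \<and> M' = N"
proof (induction arbitrary: s N rule: exec.induct)
  case (Skip M)
  then show ?case by (auto elim: SkipE)
next
  case (Write a i e M)
  then show ?case by (auto elim: WriteE)
next
  case (Seq c1 M t1 M1 c2 t2 M2)
  from Seq.prems obtain s1 N1 s2 where "exec c1 M s1 N1" "exec c2 N1 s2 N" "s = s1 + s2"
    by (auto elim: SeqE)
  with Seq.IH show ?case by metis
next
  case (CondTrue b M c1 t M' c2)
  from CondTrue.prems CondTrue.hyps(1) obtain s1 where "exec c1 M s1 N" "s = bcost b + s1 + 1"
    by (auto elim: CondE)
  with CondTrue.IH show ?case by metis
next
  case (CondFalse b M c2 t M' c1)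
  from CondFalse.prems CondFalse.hyps(1) obtain s1 where "exec c2 M s1 N" "s = bcost b + s1 + 1"
    by (auto elim: CondE)
  with CondFalse.IH show ?case by metis
next
  case (LoopFalse b M c)
  from LoopFalse.prems LoopFalse.hyps show ?case by (auto elim: LoopE)
next
  case (LoopTrue b M c t1 M1 t2 M2)
  from LoopTrue.prems obtain s1 N1 s2
    where "exec c M s1 N1" "exec (Loop b c) N1 s2 N" "s = bcost b + s1 + s2 + 1"
    by (rule LoopE) (use LoopTrue.hyps(1) in simp_all)
  with LoopTrue.IH show ?case by metis
qed

text \<open>The input is a sequence of integers, stored in array 0; all other cells are 0.
  The answer is left in cell 0 of array 1.\<close>

definition load :: "int list \<Rightarrow> mem" where
  "load xs = (\<lambda>a i. if a = 0 \<and> 0 \<le> i \<and> i < int (length xs) then xs ! nat i else 0)"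

definition answer :: "mem \<Rightarrow> int" where
  "answer M = M 1 0"


section \<open>Instances as machine input\<close>

text \<open>The vertices are \<open>0, \<dots>, n - 1\<close>, and each edge occurs exactly once in the edge list,
  in an arbitrary position and orientation.\<close>

definition lists_edges :: "(nat \<times> nat) list \<Rightarrow> nat set set \<Rightarrow> bool" where
  "lists_edges es E \<longleftrightarrow>
     distinct (map (\<lambda>(u, v). {u, v}) es) \<and> set (map (\<lambda>(u, v). {u, v}) es) = E"

definition encode :: "nat \<Rightarrow> (nat \<times> nat) list \<Rightarrow> int \<Rightarrow> int \<Rightarrow> int list" where
  "encode n es k l =
     [int n, int (length es), k, l] @ concat (map (\<lambda>(u, v). [int u, int v]) es)"

text \<open>For \<open>k \<ge> 0\<close> and \<open>l \<ge> 2\<close> this is \<open>(l - 1) ^ k * n^2 * (n + m)\<close>. Smaller \<open>l\<close> and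
  negative \<open>k\<close> are legal inputs for which that expression may vanish or be negative or
  fractional, so there the first factor is taken to be 1.\<close>

definition time_bound :: "nat \<Rightarrow> nat \<Rightarrow> int \<Rightarrow> int \<Rightarrow> nat" where
  "time_bound n m k l = nat (max 1 (l - 1)) ^ nat k * n ^ 2 * (n + m)"

end

(*
  A shortest path from s to t with fewer than l edges must lose an edge to every deletion set that
  brings t to distance at least l from s. So for every pair (s, t) one branches on the at most l - 1
  edges of such a path, found by breadth-first search, down to depth k; a node whose graph is
  disconnected is a leaf. For l > 2 the search tree has at most 2 * (l - 1)^k nodes, and for l = 2
  at most 2, since the path is then the single edge {s, t}. On the random access machine the
  recursion becomes a loop over a stack of edges to delete and to restore.
*)

theory Submission
  imports Defs
begin

section \<open>Total correctness with running times\<close>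

text \<open>Fixing the pair \<open>(s, t)\<close> before branching is what makes one short path
  decisive: the diameter is at least \<open>l\<close> exactly when some pair is at distance at least
  \<open>l\<close>, and only for a prescribed pair must every shorter path between its ends be
  destroyed. This is the origin of the factor \<open>n^2\<close>. A disconnected node can be
  abandoned because further deletions never reconnect a graph.

  The obstacle is the loop that replaces the recursion: an invariant for its single iterations would
  have to describe all pending branches at once. Instead, whole segments of iterations are
  described. An induction on the remaining budget shows that the top item of the stack, with
  everything that it causes to be pushed, is consumed at a cost of \<open>O(n + m)\<close> per node
  of its subtree, and that the deletions, the budget and the stack below are afterwards as they
  were. Success only raises a flag, so that all deletions are undone before the next pair is
  treated.\<close>

definition terminates :: "com \<Rightarrow> nat \<Rightarrow> (mem \<Rightarrow> bool) \<Rightarrow> mem \<Rightarrow> bool" where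
  "terminates c T Q M \<longleftrightarrow> (\<exists>t M'. exec c M t M' \<and> t \<le> T \<and> Q M')"

lemma terminates_mono:
  "terminates c T Q M \<Longrightarrow> T \<le> T' \<Longrightarrow> (\<And>M'. Q M' \<Longrightarrow> Q' M') \<Longrightarrow> terminates c T' Q' M"
  unfolding terminates_def by (meson le_trans)

lemma terminates_Seq:
  assumes "terminates c1 T1 P M" and "\<And>M'. P M' \<Longrightarrow> terminates c2 T2 Q M'" and "T1 + T2 \<le> T"
  shows "terminates (Seq c1 c2) T Q M"
proof -
  from assms(1) obtain t1 M1 where 1: "exec c1 M t1 M1" "t1 \<le> T1" "P M1"
    unfolding terminates_def by blast
  from assms(2)[OF 1(3)] obtain t2 M2 where "exec c2 M1 t2 M2" "t2 \<le> T2" "Q M2"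
    unfolding terminates_def by blast
  with 1 assms(3) show ?thesis
    unfolding terminates_def by (intro exI[of _ "t1 + t2"] exI[of _ M2]) (auto intro: exec.Seq)
qed

lemma terminates_CondTrue:
  assumes "bval b M" and "terminates c1 T1 Q M" and "bcost b + T1 + 1 \<le> T"
  shows "terminates (Cond b c1 c2) T Q M"
proof -
  from assms(2) obtain t M' where *: "exec c1 M t M'" "t \<le> T1" "Q M'"
    unfolding terminates_def by blast
  have "exec (Cond b c1 c2) M (bcost b + t + 1) M'" by (rule exec.CondTrue) fact+
  with * assms(3) show ?thesis
    unfolding terminates_def by (intro exI[of _ "bcost b + t + 1"] exI[of _ M']) auto
qed

lemma terminates_CondFalse:
  assumes "\<not> bval b M" and "terminates c2 T2 Q M" and "bcost b + T2 + 1 \<le> T"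
  shows "terminates (Cond b c1 c2) T Q M"
proof -
  from assms(2) obtain t M' where *: "exec c2 M t M'" "t \<le> T2" "Q M'"
    unfolding terminates_def by blast
  have "exec (Cond b c1 c2) M (bcost b + t + 1) M'" by (rule exec.CondFalse) fact+
  with * assms(3) show ?thesis
    unfolding terminates_def by (intro exI[of _ "bcost b + t + 1"] exI[of _ M']) auto
qed

text \<open>The invariant carries the time that is still available, so that the termination
  measure may depend on ghost data that it quantifies existentially.\<close>

lemma terminates_Loop:
  assumes init: "I T M"
    and body: "\<And>T M. I T M \<Longrightarrow> bval b M \<Longrightarrow>
      terminates c B (\<lambda>M'. \<exists>T'. I T' M' \<and> bcost b + B + 1 + T' \<le> T) M"
    and final: "\<And>T M. I T M \<Longrightarrow> \<not> bval b M \<Longrightarrow> bcost b + 1 \<le> T \<and> Q M"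
  shows "terminates (Loop b c) T Q M"
  using init
proof (induction T arbitrary: M rule: less_induct)
  case (less T)
  show ?case
  proof (cases "bval b M")
    case False
    then have "exec (Loop b c) M (bcost b + 1) M" by (rule exec.LoopFalse)
    with final[OF less.prems False] show ?thesis
      unfolding terminates_def by blast
  next
    case True
    from body[OF less.prems True] obtain t M' T'
      where *: "exec c M t M'" "t \<le> B" "I T' M'" "bcost b + B + 1 + T' \<le> T"
      unfolding terminates_def by blast
    \<comment> \<open>\<open>T' < T\<close>, since the loop itself is charged at least one unit per
      iteration; hence the induction hypothesis applies.\<close>
    then obtain t2 M2 where 2: "exec (Loop b c) M' t2 M2" "t2 \<le> T'" "Q M2"
      using less.IH[of T' M'] unfolding terminates_def by auto
    have "exec (Loop b c) M (bcost b + t + t2 + 1) M2"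
      by (rule exec.LoopTrue) fact+
    with * 2 show ?thesis
      unfolding terminates_def by (intro exI[of _ "bcost b + t + t2 + 1"] exI[of _ M2]) auto
  qed
qed

section \<open>Symbolic execution of loop-free code\<close>

primrec loop_free :: "com \<Rightarrow> bool" where
  "loop_free Skip \<longleftrightarrow> True"
| "loop_free (Write a i e) \<longleftrightarrow> True"
| "loop_free (Seq c1 c2) \<longleftrightarrow> loop_free c1 \<and> loop_free c2"
| "loop_free (Cond b c1 c2) \<longleftrightarrow> loop_free c1 \<and> loop_free c2"
| "loop_free (Loop b c) \<longleftrightarrow> False"

text \<open>A functional semantics for code without loops: rewriting computes the final memory, so
  that only loops need invariants.\<close>

primrec run :: "com \<Rightarrow> mem \<Rightarrow> mem" where
  "run Skip M = M"
| "run (Write a i e) M = M(a := (M a)(aval i M := aval e M))"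
| "run (Seq c1 c2) M = run c2 (run c1 M)"
| "run (Cond b c1 c2) M = (if bval b M then run c1 M else run c2 M)"
| "run (Loop b c) M = M"

primrec max_cost :: "com \<Rightarrow> nat" where
  "max_cost Skip = 1"
| "max_cost (Write a i e) = acost i + acost e + 1"
| "max_cost (Seq c1 c2) = max_cost c1 + max_cost c2"
| "max_cost (Cond b c1 c2) = bcost b + max (max_cost c1) (max_cost c2) + 1"
| "max_cost (Loop b c) = 0"

lemma terminates_run':
  "loop_free c \<Longrightarrow> terminates c (max_cost c) (\<lambda>M'. M' = run c M) M"
proof (induction c arbitrary: M)
  case Skip
  show ?case using exec.Skip unfolding terminates_def by fastforce
next
  case (Write a i e)
  show ?case using exec.Write unfolding terminates_def by fastforce
next
  case (Seq c1 c2)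
  then show ?case by (intro terminates_Seq[OF Seq.IH(1)]) auto
next
  case (Cond b c1 c2)
  show ?case
  proof (cases "bval b M")
    case True
    with Cond.IH(1)[of M] Cond.prems
    have "terminates c1 (max_cost c1) (\<lambda>M'. M' = run (Cond b c1 c2) M) M" by simp
    with True show ?thesis by (rule terminates_CondTrue) simp
  next
    case False
    with Cond.IH(2)[of M] Cond.prems
    have "terminates c2 (max_cost c2) (\<lambda>M'. M' = run (Cond b c1 c2) M) M" by simp
    with False show ?thesis by (rule terminates_CondFalse) simp
  qed
qed simp

lemma terminates_run: "loop_free c \<Longrightarrow> max_cost c \<le> T \<Longrightarrow> Q (run c M) \<Longrightarrow> terminates c T Q M"
  by (rule terminates_mono[OF terminates_run']) auto

lemma terminates_run_Seq:
  assumes "loop_free c1" "terminates c2 T2 Q (run c1 M)" "max_cost c1 + T2 \<le> T"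
  shows "terminates (Seq c1 c2) T Q M"
  using terminates_run'[OF assms(1)] by (rule terminates_Seq) (use assms in auto)

section \<open>Frame conditions\<close>

primrec writes :: "com \<Rightarrow> nat set" where
  "writes Skip = {}"
| "writes (Write a i e) = {a}"
| "writes (Seq c1 c2) = writes c1 \<union> writes c2"
| "writes (Cond b c1 c2) = writes c1 \<union> writes c2"
| "writes (Loop b c) = writes c"

lemma exec_frame: "exec c M t M' \<Longrightarrow> a \<notin> writes c \<Longrightarrow> M' a = M a"
  by (induction rule: exec.induct) auto

text \<open>Allows a specification to mention only the arrays that a program changes.\<close>

lemma terminates_frame:
  assumes "terminates c T Q M"
  shows "terminates c T (\<lambda>M'. Q M' \<and> (\<forall>a. a \<notin> writes c \<longrightarrow> M' a = M a)) M"
  using assms exec_frame unfolding terminates_def by metis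

text \<open>\<open>iter b c M t M'\<close>: some number of iterations of the loop, after which its
  condition need not fail.\<close>

inductive iter :: "bexp \<Rightarrow> com \<Rightarrow> mem \<Rightarrow> nat \<Rightarrow> mem \<Rightarrow> bool" for b c where
  refl: "iter b c M 0 M"
| step: "bval b M \<Longrightarrow> exec c M t1 M1 \<Longrightarrow> iter b c M1 t2 M2 \<Longrightarrow>
           iter b c M (bcost b + t1 + 1 + t2) M2"

lemma iter_trans:
  "iter b c M t1 M1 \<Longrightarrow> iter b c M1 t2 M2 \<Longrightarrow> iter b c M (t1 + t2) M2"
proof (induction rule: iter.induct)
  case (step M s1 M1 s2 M2')
  then have "iter b c M (bcost b + s1 + 1 + (s2 + t2)) M2"
    by (intro iter.step) auto
  then show ?case by (simp add: add.assoc)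
qed simp

lemma iter_Loop:
  "iter b c M t M' \<Longrightarrow> \<not> bval b M' \<Longrightarrow> exec (Loop b c) M (t + bcost b + 1) M'"
proof (induction rule: iter.induct)
  case (refl M)
  then show ?case using exec.LoopFalse by simp
next
  case (step M t1 M1 t2 M2)
  then have "exec (Loop b c) M (bcost b + t1 + (t2 + bcost b + 1) + 1) M2"
    by (intro exec.LoopTrue) auto
  then show ?case by (simp add: ac_simps)
qed

section \<open>Paths and distances\<close>

lemma is_path_edge_in:
  "is_path V E u p v \<Longrightarrow> E \<subseteq> E' \<Longrightarrow> is_path V E' u p v"
  unfolding is_path_def by (metis (no_types, lifting) subsetD successively_mono)

lemma is_path_single: "u \<in> V \<Longrightarrow> is_path V E u [u] u"
  by (simp add: is_path_def)

lemma is_path_snoc: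
  assumes "is_path V E u p v" "w \<in> V" "w \<notin> set p" "{v, w} \<in> E"
  shows "is_path V E u (p @ [w]) w"
  using assms unfolding is_path_def by (auto simp: successively_append_iff)

lemma is_path_prefix:
  assumes "is_path V E u p v" "w \<in> set p"
  shows "\<exists>q. is_path V E u q w"
proof -
  from assms(2) obtain xs ys where "p = xs @ w # ys" by (meson split_list)
  then have p: "p = (xs @ [w]) @ ys" by simp
  have "is_path V E u (xs @ [w]) w"
    using assms(1) unfolding is_path_def p successively_append_iff[of _ "xs @ [w]"] by (auto simp: hd_append)
  then show ?thesis by blast
qed

section \<open>Reachability and connectivity\<close>

text \<open>Paths are free of repetitions, so two of them cannot simply be appended. The reflexive
  transitive closure of this relation is transitive for free.\<close>

definition adjacency :: "'a set \<Rightarrow> 'a set set \<Rightarrow> ('a \<times> 'a) set" where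
  "adjacency V E = {(x, y). x \<in> V \<and> y \<in> V \<and> {x, y} \<in> E}"

text \<open>A step to a new vertex extends the path; a step back to a vertex on the path is answered
  by a prefix.\<close>

lemma path_of_reachable:
  assumes "(u, v) \<in> (adjacency V E)\<^sup>*" "u \<in> V"
  shows "\<exists>p. is_path V E u p v"
  using assms(1)
proof (induction rule: rtrancl_induct)
  case base
  show ?case by (rule exI[of _ "[u]"]) (rule is_path_single[OF assms(2)])
next
  case (step y z)
  then obtain p where p: "is_path V E u p y" by blast
  show ?case
  proof (cases "z \<in> set p")
    case True
    show ?thesis by (rule is_path_prefix[OF p True])
  next
    case False
    have "z \<in> V" "{y, z} \<in> E" using step(2) by (auto simp: adjacency_def)
    from is_path_snoc[OF p this(1) False this(2)] show ?thesis by (rule exI)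
  qed
qed

lemma reachable_of_path:
  assumes "is_path V E u p v"
  shows "(u, v) \<in> (adjacency V E)\<^sup>*"
  using assms
proof (induction p arbitrary: v rule: rev_induct)
  case Nil
  then show ?case by (simp add: is_path_def)
next
  case (snoc x p)
  show ?case
  proof (cases "p = []")
    case True
    with snoc.prems show ?thesis by (auto simp: is_path_def)
  next
    case False
    with snoc.prems have "is_path V E u p (last p)" "(last p, v) \<in> adjacency V E"
      by (auto simp: is_path_def adjacency_def successively_append_iff)
    with snoc.IH[of "last p"] show ?thesis by (blast intro: rtrancl_into_rtrancl)
  qed
qed

lemma sym_adjacency: "sym (adjacency V E)"
  by (auto simp: sym_def adjacency_def insert_commute)

text \<open>Edges are undirected, so any two vertices are joined through \<open>s\<close>. Hence a
  single search from \<open>s\<close> decides connectivity.\<close>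

lemma graph_connected_from:
  assumes "s \<in> V"
  shows "graph_connected V E \<longleftrightarrow> (\<forall>v\<in>V. \<exists>p. is_path V E s p v)"
proof
  assume *: "\<forall>v\<in>V. \<exists>p. is_path V E s p v"
  have "\<exists>p. is_path V E u p v" if "u \<in> V" "v \<in> V" for u v
  proof -
    from * that obtain p q where "is_path V E s p u" "is_path V E s q v" by blast
    then have "(s, u) \<in> (adjacency V E)\<^sup>*" "(s, v) \<in> (adjacency V E)\<^sup>*"
      by (blast intro: reachable_of_path)+
    moreover from this(1) have "(u, s) \<in> (adjacency V E)\<^sup>*"
      using symD[OF sym_rtrancl[OF sym_adjacency]] by fast
    ultimately have "(u, v) \<in> (adjacency V E)\<^sup>*" by (blast intro: rtrancl_trans)
    with that show ?thesis by (simp add: path_of_reachable)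
  qed
  with assms show "graph_connected V E" by (auto simp: graph_connected_def)
next
  assume "graph_connected V E"
  with assms show "\<forall>v\<in>V. \<exists>p. is_path V E s p v" by (simp add: graph_connected_def)
qed

lemma graph_connected_mono:
  "graph_connected V E \<Longrightarrow> E \<subseteq> E' \<Longrightarrow> graph_connected V E'"
  unfolding graph_connected_def by (blast intro: is_path_edge_in)

section \<open>Distances and the diameter\<close>

lemma graph_dist_le:
  "is_path V E u p v \<Longrightarrow> length p = d + 1 \<Longrightarrow> graph_dist V E u v \<le> d"
  unfolding graph_dist_def by (rule Least_le) blast

lemma graph_dist_attained:
  assumes "is_path V E u p v"
  obtains q where "is_path V E u q v" "length q = graph_dist V E u v + 1"
proof -
  let ?P = "\<lambda>d. \<exists>q. is_path V E u q v \<and> length q = d + 1"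
  have "length p = length p - 1 + 1" using assms by (cases p) (simp_all add: is_path_def)
  with assms have "?P (length p - 1)" by blast
  then have "?P (graph_dist V E u v)" unfolding graph_dist_def by (rule LeastI[of ?P])
  with that show thesis by blast
qed

lemma graph_dist_self: "u \<in> V \<Longrightarrow> graph_dist V E u u = 0"
  using graph_dist_le[OF is_path_single, of u V 0 E] by simp

lemma graph_diameter_ge:
  assumes "finite V" "V \<noteq> {}"
  shows "l \<le> int (graph_diameter V E) \<longleftrightarrow> (\<exists>u\<in>V. \<exists>v\<in>V. l \<le> int (graph_dist V E u v))"
proof -
  let ?D = "insert 0 {graph_dist V E u v | u v. u \<in> V \<and> v \<in> V \<and> u \<noteq> v}"
  have "{graph_dist V E u v | u v. u \<in> V \<and> v \<in> V \<and> u \<noteq> v}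
      \<subseteq> (\<lambda>(u, v). graph_dist V E u v) ` (V \<times> V)" by auto
  with assms have fin: "finite ?D" by (simp add: finite_subset)
  show ?thesis
  proof
    assume l: "l \<le> int (graph_diameter V E)"
    have "graph_diameter V E \<in> ?D" unfolding graph_diameter_def by (rule Max_in) (use fin in auto)
    moreover obtain u where "u \<in> V" using assms by blast
    ultimately show "\<exists>u\<in>V. \<exists>v\<in>V. l \<le> int (graph_dist V E u v)"
      using l graph_dist_self[of u V E] by fastforce
  next
    assume "\<exists>u\<in>V. \<exists>v\<in>V. l \<le> int (graph_dist V E u v)"
    then obtain u v where uv: "u \<in> V" "v \<in> V" "l \<le> int (graph_dist V E u v)" by blast
    have "graph_dist V E u v \<in> ?D" using uv graph_dist_self[of u V E] by (cases "u = v") auto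
    then have "graph_dist V E u v \<le> graph_diameter V E"
      unfolding graph_diameter_def using fin by (rule Max_ge[rotated])
    with uv show "l \<le> int (graph_diameter V E)" by linarith
  qed
qed

section \<open>Distance labels\<close>

text \<open>The labels produced by a breadth-first search from \<open>s\<close>: label 0 means that the
  vertex was not reached, and otherwise the label is the distance from \<open>s\<close> plus 1.\<close>

locale dist_labels =
  fixes V :: "'a set" and E :: "'a set set" and s :: 'a and d :: "'a \<Rightarrow> nat" and p :: "'a \<Rightarrow> 'a"
  assumes source: "s \<in> V" "d s = 1"
    and parent: "v \<in> V \<Longrightarrow> d v \<noteq> 0 \<Longrightarrow> v \<noteq> s \<Longrightarrow>
      p v \<in> V \<and> d (p v) \<noteq> 0 \<and> d v = d (p v) + 1 \<and> {p v, v} \<in> E"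
    and edge: "u \<in> V \<Longrightarrow> w \<in> V \<Longrightarrow> {u, w} \<in> E \<Longrightarrow> d u \<noteq> 0 \<Longrightarrow> d w \<noteq> 0 \<and> d w \<le> d u + 1"
begin

text \<open>The lower bound on distances: the label is 1 at \<open>s\<close> and rises by at most 1
  along each edge of any path.\<close>

lemma label_le_length:
  assumes "is_path V E s q v"
  shows "d v \<noteq> 0 \<and> d v \<le> length q"
  using assms
proof (induction q arbitrary: v rule: rev_induct)
  case Nil
  then show ?case by (simp add: is_path_def)
next
  case (snoc x q)
  show ?case
  proof (cases "q = []")
    case True
    with snoc.prems source show ?thesis by (auto simp: is_path_def)
  next
    case False
    with snoc.prems have "is_path V E s q (last q)" "last q \<in> V" "v \<in> V" "{last q, v} \<in> E"
      by (auto simp: is_path_def successively_append_iff)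
    with snoc.IH edge show ?thesis by fastforce
  qed
qed

text \<open>The edge set \<open>W\<close> need not be \<open>E\<close>: the parent path survives the deletion of
  edges that do not lie on it.\<close>

lemma parent_path:
  assumes "v \<in> V" "d v = Suc D" "\<And>i. i < D \<Longrightarrow> {(p ^^ Suc i) v, (p ^^ i) v} \<in> W"
  shows "\<exists>q. is_path V W s q v \<and> length q = Suc D \<and> (\<forall>x\<in>set q. d x \<le> Suc D)"
  using assms
proof (induction D arbitrary: v)
  case 0
  have "v = s" using 0 parent[of v] by (cases "v = s") auto
  with 0 show ?case using is_path_single by (intro exI[of _ "[s]"]) auto
next
  case (Suc D)
  then have "v \<noteq> s" using source by auto
  with Suc.prems parent[of v] have pv: "p v \<in> V" "d (p v) = Suc D" by auto
  have "\<exists>q. is_path V W s q (p v) \<and> length q = Suc D \<and> (\<forall>x\<in>set q. d x \<le> Suc D)"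
  proof (rule Suc.IH[OF pv])
    fix i assume "i < D"
    with Suc.prems(3)[of "Suc i"] show "{(p ^^ Suc i) (p v), (p ^^ i) (p v)} \<in> W"
      by (simp add: funpow_swap1)
  qed
  then obtain q where q: "is_path V W s q (p v)" "length q = Suc D" "\<forall>x\<in>set q. d x \<le> Suc D"
    by blast
  \<comment> \<open>The labels on \<open>q\<close> are at most \<open>Suc D\<close>, one less than
    the label of \<open>v\<close>, so \<open>v\<close> does not lie on \<open>q\<close>. The bound
    on labels is carried through the induction for this purpose.\<close>
  have "is_path V W s (q @ [v]) v"
    by (rule is_path_snoc[OF q(1)]) (use q Suc.prems Suc.prems(3)[of 0] in auto)
  with q Suc.prems show ?case by (intro exI[of _ "q @ [v]"]) auto
qed

lemma parent_chain:
  assumes "v \<in> V" "d v = Suc D" "i \<le> D"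
  shows "(p ^^ i) v \<in> V \<and> d ((p ^^ i) v) = Suc D - i"
  using assms(3)
proof (induction i)
  case 0
  then show ?case using assms by simp
next
  case (Suc i)
  then have "(p ^^ i) v \<in> V" "d ((p ^^ i) v) = Suc D - i" by auto
  moreover from this Suc.prems source have "(p ^^ i) v \<noteq> s" by auto
  ultimately show ?case using parent[of "(p ^^ i) v"] Suc.prems by auto
qed

lemma parent_chain_not_source:
  assumes "v \<in> V" "d v = Suc D" "i < D"
  shows "(p ^^ i) v \<noteq> s"
  using parent_chain[OF assms(1,2), of i] assms(3) source by auto

text \<open>After \<open>D\<close> steps the label is 1. Any labelled vertex other than
  \<open>s\<close> has a parent with a positive label, hence a label of at least 2.\<close>

lemma parent_chain_source:
  assumes "v \<in> V" "d v = Suc D"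
  shows "(p ^^ D) v = s"
  using parent_chain[OF assms, of D] parent[of "(p ^^ D) v"] by fastforce

lemma parent_chain_edge:
  assumes "v \<in> V" "d v = Suc D" "i < D"
  shows "{(p ^^ Suc i) v, (p ^^ i) v} \<in> E"
  using parent_chain[OF assms(1,2), of i] parent_chain_not_source[OF assms] assms(3)
    parent[of "(p ^^ i) v"] by auto

lemma path_of_label:
  assumes "v \<in> V" "d v = Suc D"
  obtains q where "is_path V E s q v" "length q = Suc D"
  using parent_path[OF assms parent_chain_edge[OF assms]] by blast

lemma connected_iff: "graph_connected V E \<longleftrightarrow> (\<forall>v\<in>V. d v \<noteq> 0)"
proof -
  have "(\<exists>q. is_path V E s q v) \<longleftrightarrow> d v \<noteq> 0" if "v \<in> V" for v
  proof
    assume "d v \<noteq> 0"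
    then obtain D where "d v = Suc D" by (cases "d v") auto
    from path_of_label[OF that this] show "\<exists>q. is_path V E s q v" by blast
  next
    assume "\<exists>q. is_path V E s q v"
    then obtain q where "is_path V E s q v" ..
    then show "d v \<noteq> 0" by (simp add: label_le_length)
  qed
  then show ?thesis unfolding graph_connected_from[OF source(1)] by simp
qed

lemma dist_eq:
  assumes "v \<in> V" "d v = Suc D"
  shows "graph_dist V E s v = D"
proof -
  obtain q where q: "is_path V E s q v" "length q = Suc D" using path_of_label[OF assms] .
  with graph_dist_le[OF q(1)] have "graph_dist V E s v \<le> D" by simp
  moreover obtain r where "is_path V E s r v" "length r = graph_dist V E s v + 1"
    using graph_dist_attained[OF q(1)] .
  ultimately show ?thesis using label_le_length[of r v] assms by auto
qed

end

section \<open>Branching on the edges of a shortest path\<close>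

locale edge_list =
  fixes n :: nat and es :: "(nat \<times> nat) list"
  assumes n_pos: "0 < n"
    and ends: "(u, v) \<in> set es \<Longrightarrow> u < n \<and> v < n \<and> u \<noteq> v"
    and distinct_edges: "distinct (map (\<lambda>(u, v). {u, v}) es)"
begin

definition m :: nat where "m = length es"

definition edge :: "nat \<Rightarrow> nat set" where "edge i = {fst (es ! i), snd (es ! i)}"

text \<open>Deletion sets consist of indices into \<open>es\<close>, because these are what the
  program marks; by \<open>inj_edge\<close> nothing is lost compared with sets of edges.\<close>

definition live :: "nat set \<Rightarrow> nat set set" where "live X = edge ` ({..<m} - X)"

lemma edge_ends: "i < m \<Longrightarrow> fst (es ! i) < n \<and> snd (es ! i) < n \<and> fst (es ! i) \<noteq> snd (es ! i)"
  using ends[of "fst (es ! i)" "snd (es ! i)"] by (simp add: m_def)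

lemma inj_edge: "inj_on edge {..<m}"
proof (rule inj_onI)
  fix i j assume "i \<in> {..<m}" "j \<in> {..<m}" "edge i = edge j"
  then show "i = j"
    using nth_eq_iff_index_eq[OF distinct_edges, of i j]
    by (simp add: m_def edge_def case_prod_beta)
qed

lemma edge_in_live_iff: "i < m \<Longrightarrow> edge i \<in> live X \<longleftrightarrow> i \<notin> X"
  unfolding live_def using inj_edge by (auto dest: inj_onD)

lemma live_antimono: "X \<subseteq> Y \<Longrightarrow> live Y \<subseteq> live X"
  unfolding live_def by blast

definition good :: "int \<Rightarrow> nat \<Rightarrow> nat \<Rightarrow> nat set \<Rightarrow> bool" where
  "good l s t X \<longleftrightarrow> graph_connected {..<n} (live X) \<and> l \<le> int (graph_dist {..<n} (live X) s t)"

definition leaf :: "int \<Rightarrow> nat \<Rightarrow> nat \<Rightarrow> nat set \<Rightarrow> bool" where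
  "leaf l s t X \<longleftrightarrow> \<not> graph_connected {..<n} (live X) \<or> good l s t X"

text \<open>The index \<open>m\<close> belongs to no edge; the root of the search tree deletes it.\<close>

definition sol :: "int \<Rightarrow> nat \<Rightarrow> nat \<Rightarrow> nat set \<Rightarrow> nat \<Rightarrow> bool" where
  "sol l s t X r \<longleftrightarrow> (\<exists>Y. X \<subseteq> Y \<and> Y \<subseteq> {..m} \<and> card (Y - X) \<le> r \<and> good l s t Y)"

text \<open>Bounds the number of nodes of the search tree. For \<open>l = 2\<close> the only branch deletes
  the edge between \<open>s\<close> and \<open>t\<close> and ends in a leaf, whatever the remaining budget is.\<close>

definition nodes :: "int \<Rightarrow> nat \<Rightarrow> nat \<Rightarrow> nat set \<Rightarrow> nat \<Rightarrow> nat" where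
  "nodes l s t X r =
     (if leaf l s t X \<or> r = 0 then 1 else if l \<le> 2 then 2 else 2 * nat (l - 1) ^ r - 1)"

lemma full_tree_ge_1: "2 < l \<Longrightarrow> 1 \<le> 2 * nat (l - 1) ^ r - 1"
proof -
  assume "2 < l"
  then have "(1::nat) \<le> nat (l - 1) ^ r" by simp
  then show ?thesis by linarith
qed

lemma nodes_ge_1: "1 \<le> nodes l s t X r"
  using full_tree_ge_1[of l r] by (auto simp: nodes_def)

lemma nodes_le_full_tree: "2 < l \<Longrightarrow> nodes l s t X r \<le> 2 * nat (l - 1) ^ r - 1"
  using full_tree_ge_1[of l r] by (auto simp: nodes_def)

lemma nodes_le: "nodes l s t X r \<le> 2 * nat (max 1 (l - 1)) ^ r"
proof (cases "l \<le> 2")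
  case True
  then show ?thesis by (simp add: nodes_def)
next
  case False
  then show ?thesis using nodes_le_full_tree[of l s t X r] by (simp add: max_def)
qed

lemma sol_if_good: "X \<subseteq> {..m} \<Longrightarrow> good l s t X \<Longrightarrow> sol l s t X r"
  unfolding sol_def by (intro exI[of _ X]) auto

lemma sol_0: "X \<subseteq> {..m} \<Longrightarrow> sol l s t X 0 \<longleftrightarrow> good l s t X"
proof
  assume X: "X \<subseteq> {..m}" and "sol l s t X 0"
  then obtain Y where Y: "X \<subseteq> Y" "Y \<subseteq> {..m}" "card (Y - X) = 0" "good l s t Y"
    unfolding sol_def by auto
  then have "finite (Y - X)" by (meson finite_Diff finite_subset finite_atMost)
  with Y have "Y = X" by auto
  with Y show "good l s t X" by simp
qed (rule sol_if_good)

text \<open>Removing more edges cannot restore connectivity, which is why a disconnected node has no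
  solution below it.\<close>

lemma sol_connected: "sol l s t X r \<Longrightarrow> graph_connected {..<n} (live X)"
  unfolding sol_def good_def by (meson graph_connected_mono live_antimono)

lemma sol_leaf: "X \<subseteq> {..m} \<Longrightarrow> leaf l s t X \<Longrightarrow> sol l s t X r \<longleftrightarrow> good l s t X"
  using sol_if_good sol_connected unfolding leaf_def by blast

end

text \<open>A node of the search tree after its breadth-first search: \<open>X\<close> is deleted,
  \<open>t\<close> was reached at distance \<open>D\<close>, and \<open>pe\<close> gives the index
  of the tree edge into each reached vertex.\<close>

locale branching = edge_list + dist_labels "{..<n}" "live X" s d p
  for X :: "nat set" and s :: nat and d p :: "nat \<Rightarrow> nat" +
  fixes pe :: "nat \<Rightarrow> nat" and t :: nat and D :: nat
  assumes X: "X \<subseteq> {..m}"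
    and parent_edge: "v < n \<Longrightarrow> d v \<noteq> 0 \<Longrightarrow> v \<noteq> s \<Longrightarrow> pe v < m \<and> pe v \<notin> X \<and> edge (pe v) = {p v, v}"
    and t: "t < n" "d t = Suc D"
begin

text \<open>The edges of the shortest path found, from \<open>t\<close> back to \<open>s\<close>, in
  the order in which the program pushes them.\<close>

definition branches :: "nat list" where "branches = map (\<lambda>i. pe ((p ^^ i) t)) [0..<D]"

lemma length_branches: "length branches = D"
  by (simp add: branches_def)

lemma chain_edge:
  assumes "i < D"
  shows "pe ((p ^^ i) t) < m \<and> pe ((p ^^ i) t) \<notin> X \<and>
    edge (pe ((p ^^ i) t)) = {(p ^^ Suc i) t, (p ^^ i) t}"
  using parent_edge[of "(p ^^ i) t"] parent_chain[of t D i] parent_chain_not_source[of t D i] t assms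
  by auto

lemma branches_subset: "set branches \<subseteq> {..<m} - X"
  unfolding branches_def using chain_edge by auto

text \<open>If \<open>Y\<close> avoided all these edges, the parent path would survive in
  \<open>live Y\<close> and keep \<open>t\<close> within distance \<open>D\<close>. This is why
  \<open>parent_path\<close> allows a second edge set.\<close>

lemma branch_hit:
  assumes "good l s t Y" "int D < l" "Y \<subseteq> {..m}"
  shows "set branches \<inter> Y \<noteq> {}"
proof
  assume *: "set branches \<inter> Y = {}"
  have "\<exists>q. is_path {..<n} (live Y) s q t \<and> length q = Suc D \<and> (\<forall>x\<in>set q. d x \<le> Suc D)"
  proof (rule parent_path)
    fix i assume i: "i < D"
    then have "pe ((p ^^ i) t) \<in> set branches" by (simp add: branches_def)
    with * have "pe ((p ^^ i) t) \<notin> Y" by blast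
    with chain_edge[OF i] show "{(p ^^ Suc i) t, (p ^^ i) t} \<in> live Y"
      using edge_in_live_iff by metis
  qed (use t in auto)
  then have "graph_dist {..<n} (live Y) s t \<le> D" using graph_dist_le by fastforce
  with assms show False by (simp add: good_def)
qed

lemma not_leaf_dist: "\<not> leaf l s t X \<Longrightarrow> int D < l"
  using dist_eq[of t D] t by (auto simp: leaf_def good_def)

text \<open>The path lies in \<open>live X\<close>, so an edge of it that \<open>Y\<close> deletes
  is not in \<open>X\<close>; moving it into the deletion set uses exactly one unit of the
  budget.\<close>

lemma sol_branch:
  assumes "\<not> leaf l s t X"
  shows "sol l s t X (Suc r) \<longleftrightarrow> (\<exists>e\<in>set branches. sol l s t (insert e X) r)"
proof
  assume "sol l s t X (Suc r)"
  then obtain Y where Y: "X \<subseteq> Y" "Y \<subseteq> {..m}" "card (Y - X) \<le> Suc r" "good l s t Y"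
    unfolding sol_def by auto
  with branch_hit not_leaf_dist[OF assms] obtain e where e: "e \<in> set branches" "e \<in> Y"
    by blast
  with branches_subset have "e \<in> Y - X" by blast
  moreover have "finite (Y - X)" using Y(2) by (meson finite_Diff finite_subset finite_atMost)
  ultimately have "card (Y - X) = Suc (card (Y - X - {e}))" using card_Suc_Diff1 by metis
  moreover have "Y - insert e X = Y - X - {e}" by blast
  ultimately have "card (Y - insert e X) \<le> r" using Y(3) by simp
  with Y e show "\<exists>e\<in>set branches. sol l s t (insert e X) r"
    unfolding sol_def by (intro bexI[of _ e] exI[of _ Y]) auto
next
  assume "\<exists>e\<in>set branches. sol l s t (insert e X) r"
  then obtain e Y where e: "e \<in> set branches"
    and Y: "insert e X \<subseteq> Y" "Y \<subseteq> {..m}" "card (Y - insert e X) \<le> r" "good l s t Y"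
    unfolding sol_def by auto
  have "card (Y - X) \<le> card (insert e (Y - insert e X))"
    by (rule card_mono) (use Y(2) in \<open>auto intro: finite_subset\<close>)
  also have "\<dots> \<le> Suc r" using Y(3) card_insert_le_m1 
    by (metis card_insert_if finite_Diff finite_subset finite_atMost Y(2) le_SucI not_less_eq_eq)
  finally show "sol l s t X (Suc r)" unfolding sol_def using Y by (intro exI[of _ Y]) auto
qed

text \<open>Without the edge \<open>{s, t}\<close> the graph is either disconnected or has
  \<open>s\<close> and \<open>t\<close> at distance at least 2, which is already enough.\<close>

lemma leaf_adjacent:
  assumes "D = 1" "l \<le> 2" "e \<in> set branches"
  shows "leaf l s t (insert e X)"
proof -
  have e: "e = pe t" using assms(1,3) unfolding branches_def by simp
  have pt: "p t = s" using parent_chain_source[of t D] t assms by simp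
  have ee: "e < m" "edge e = {s, t}" using chain_edge[of 0] assms(1) e pt by auto
  have st: "s \<noteq> t" using t source assms(1) by auto
  have "2 \<le> graph_dist {..<n} (live (insert e X)) s t"
    if "graph_connected {..<n} (live (insert e X))"
  proof -
    from that t source obtain q0 where "is_path {..<n} (live (insert e X)) s q0 t"
      unfolding graph_connected_def by blast
    then obtain q where q: "is_path {..<n} (live (insert e X)) s q t"
        "length q = graph_dist {..<n} (live (insert e X)) s t + 1"
      by (rule graph_dist_attained)
    have "length q \<noteq> 1"
    proof
      assume "length q = 1"
      then obtain a where "q = [a]" by (auto simp: length_Suc_conv)
      with q st show False by (auto simp: is_path_def)
    qed
    moreover have "length q \<noteq> 2"
    proof
      assume "length q = 2"
      then obtain a b where "q = [a, b]" by (auto simp: length_Suc_conv numeral_2_eq_2)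
      with q have "{s, t} \<in> live (insert e X)" by (auto simp: is_path_def)
      with ee edge_in_live_iff[of e "insert e X"] show False by simp
    qed
    ultimately show ?thesis using q(2) by linarith
  qed
  with assms show ?thesis by (auto simp: leaf_def good_def)
qed

text \<open>The closed form in \<open>nodes\<close> is chosen to make this recursion go through.
  With \<open>b = l - 1\<close>, at most \<open>b\<close> children of size
  \<open>2 * b ^ r - 1\<close> and the node itself add up to at most
  \<open>2 * b ^ Suc r - b + 1\<close>, which is within the bound \<open>2 * b ^ Suc r - 1\<close>
  exactly because \<open>b\<close> is at least 2. For \<open>b = 1\<close> this fails, hence the
  separate case \<open>l \<le> 2\<close>.\<close>

lemma nodes_branch:
  assumes "\<not> leaf l s t X"
  shows "1 + (\<Sum>e\<leftarrow>branches. nodes l s t (insert e X) r) \<le> nodes l s t X (Suc r)"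
proof (cases "l \<le> 2")
  case True
  \<comment> \<open>\<open>D = 0\<close> is the case \<open>s = t\<close>, in which there is no edge
    to branch on.\<close>
  with not_leaf_dist[OF assms] consider "D = 0" | "D = 1" by linarith
  then have "(\<Sum>e\<leftarrow>branches. nodes l s t (insert e X) r) \<le> 1"
  proof cases
    case 1
    then show ?thesis unfolding branches_def by simp
  next
    case 2
    then have "branches = [pe t]" unfolding branches_def by simp
    with leaf_adjacent[OF 2 True] show ?thesis by (simp add: nodes_def)
  qed
  with assms True show ?thesis by (simp add: nodes_def)
next
  case False
  define b where "b = nat (l - 1)"
  have b: "2 \<le> b" "D \<le> b" using False not_leaf_dist[OF assms] by (auto simp: b_def)
  have "(\<Sum>e\<leftarrow>branches. nodes l s t (insert e X) r) \<le> (\<Sum>e\<leftarrow>branches. 2 * b ^ r - 1)"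
    by (rule sum_list_mono) (use nodes_le_full_tree False b_def in auto)
  also have "\<dots> = D * (2 * b ^ r - 1)" 
    by (simp add: sum_list_triv length_branches)
  also have "\<dots> \<le> b * (2 * b ^ r - 1)" using b by simp
  also have "\<dots> = 2 * b ^ Suc r - b" by (simp add: diff_mult_distrib2)
  also have "\<dots> \<le> 2 * b ^ Suc r - 2" using b by simp
  finally have "(\<Sum>e\<leftarrow>branches. nodes l s t (insert e X) r) \<le> 2 * b ^ Suc r - 2" .
  moreover have "1 \<le> b ^ Suc r" using b by simp
  moreover have "nodes l s t X (Suc r) = 2 * b ^ Suc r - 1"
    using assms False by (simp add: nodes_def b_def)
  ultimately show ?thesis by linarith
qed

end

section \<open>From sets of edge indices back to the decision problem\<close>

context edge_list
begin

lemma live_deletion: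
  assumes "Y \<subseteq> {..m}"
  shows "live {} - edge ` (Y \<inter> {..<m}) = live Y" "card (edge ` (Y \<inter> {..<m})) = card (Y - {m})"
proof -
  show "live {} - edge ` (Y \<inter> {..<m}) = live Y"
    unfolding live_def using inj_edge by (auto dest: inj_onD)
  have "Y \<inter> {..<m} = Y - {m}" using assms by auto
  then show "card (edge ` (Y \<inter> {..<m})) = card (Y - {m})"
    using card_image[OF inj_on_subset[OF inj_edge]] by (metis Int_lower2)
qed

lemma MDED_iff_sol:
  assumes "0 \<le> k"
  shows "MDED {..<n} (live {}) k l \<longleftrightarrow> (\<exists>s<n. \<exists>t<n. sol l s t {m} (nat k))"
proof
  assume "MDED {..<n} (live {}) k l"
  then obtain F where F: "F \<subseteq> live {}" "int (card F) \<le> k" "graph_connected {..<n} (live {} - F)"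
    "l \<le> int (graph_diameter {..<n} (live {} - F))" unfolding MDED_def by blast
  then obtain s t where st: "s < n" "t < n" "l \<le> int (graph_dist {..<n} (live {} - F) s t)"
    using graph_diameter_ge[of "{..<n}" l "live {} - F"] n_pos by auto
  \<comment> \<open>The dummy index \<open>m\<close> is added because the root of the search tree
    already contains it; the budget counts only \<open>Y - {m}\<close>.\<close>
  define Y where "Y = insert m {i. i < m \<and> edge i \<in> F}"
  have Y: "Y \<subseteq> {..m}" by (auto simp: Y_def)
  have "edge ` (Y \<inter> {..<m}) = F" using F(1) by (auto simp: Y_def live_def)
  with live_deletion[OF Y] have "live {} - F = live Y" "card F = card (Y - {m})" by auto
  with F st Y have "sol l s t {m} (nat k)" unfolding sol_def good_def
    by (intro exI[of _ Y]) (auto simp: Y_def)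
  with st show "\<exists>s<n. \<exists>t<n. sol l s t {m} (nat k)" by blast
next
  assume "\<exists>s<n. \<exists>t<n. sol l s t {m} (nat k)"
  then obtain s t Y where st: "s < n" "t < n"
    and Y: "Y \<subseteq> {..m}" "card (Y - {m}) \<le> nat k" "good l s t Y"
    unfolding sol_def by blast
  note * = live_deletion[OF Y(1)]
  have "l \<le> int (graph_diameter {..<n} (live Y))"
    using graph_diameter_ge[of "{..<n}" l "live Y"] st Y(3) by (auto simp: good_def)
  moreover have "edge ` (Y \<inter> {..<m}) \<subseteq> live {}" by (auto simp: live_def)
  ultimately show "MDED {..<n} (live {}) k l"
    unfolding MDED_def using Y assms *
    by (intro exI[of _ "edge ` (Y \<inter> {..<m})"]) (auto simp: good_def)
qed

end

section \<open>Breadth-first search\<close>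

context edge_list
begin

text \<open>Edge \<open>i\<close> gives rise to the half-edges \<open>2 * i + 2\<close> and \<open>2 * i + 3\<close>. With this numbering
  the source of half-edge \<open>j\<close> is in cell \<open>j + 2\<close> of the input, and 0 is free to serve as the
  end marker of the adjacency lists.\<close>

definition half_edges :: "nat set" where "half_edges = {2..<2 * m + 2}"

definition eid :: "nat \<Rightarrow> nat" where "eid j = j div 2 - 1"

definition src :: "nat \<Rightarrow> nat" where
  "src j = (if even j then fst (es ! eid j) else snd (es ! eid j))"

definition tgt :: "nat \<Rightarrow> nat" where
  "tgt j = (if even j then snd (es ! eid j) else fst (es ! eid j))"

text \<open>Reversed, because the program inserts each half-edge at the front of its list.\<close>

definition adj :: "nat \<Rightarrow> nat list" where
  "adj v = rev (filter (\<lambda>j. src j = v) [2..<2 * m + 2])"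

lemma half_edge:
  assumes "j \<in> half_edges"
  shows "eid j < m" "src j < n" "tgt j < n" "edge (eid j) = {src j, tgt j}"
proof -
  show *: "eid j < m" using assms by (auto simp: eid_def half_edges_def)
  from edge_ends[OF this] show "src j < n" "tgt j < n" by (auto simp: src_def tgt_def)
  show "edge (eid j) = {src j, tgt j}" by (auto simp: src_def tgt_def edge_def)
qed

lemma half_edge_of_edge:
  assumes "i < m" "edge i = {u, w}" 
  obtains j where "j \<in> half_edges" "eid j = i" "src j = u" "tgt j = w"
proof -
  from assms(2) have "fst (es ! i) = u \<and> snd (es ! i) = w \<or> fst (es ! i) = w \<and> snd (es ! i) = u"
    by (auto simp: edge_def doubleton_eq_iff)
  then show thesis
  proof
    assume "fst (es ! i) = u \<and> snd (es ! i) = w"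
    with assms(1) show thesis
      by (intro that[of "2 * i + 2"]) (auto simp: half_edges_def eid_def src_def tgt_def)
  next
    assume "fst (es ! i) = w \<and> snd (es ! i) = u"
    with assms(1) show thesis
      by (intro that[of "2 * i + 3"]) (auto simp: half_edges_def eid_def src_def tgt_def)
  qed
qed

lemma adj_props: "distinct (adj v)" "set (adj v) = {j \<in> half_edges. src j = v}"
  by (auto simp: adj_def half_edges_def)

text \<open>The queue is \<open>qs\<close>, of which the first \<open>k\<close> vertices have been taken out; \<open>js\<close> are the
  half-edges out of the last of these that are still to be scanned.\<close>

definition bfs_inv ::
  "nat set \<Rightarrow> nat \<Rightarrow> nat list \<Rightarrow> nat \<Rightarrow> nat list \<Rightarrow>
    (nat \<Rightarrow> nat) \<Rightarrow> (nat \<Rightarrow> nat) \<Rightarrow> (nat \<Rightarrow> nat) \<Rightarrow> bool" where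
  "bfs_inv X s qs k js d p pe \<longleftrightarrow>
     s < n \<and> d s = 1 \<and> distinct qs \<and> set qs = {v. v < n \<and> d v \<noteq> 0} \<and> 1 \<le> k \<and> k \<le> length qs \<and>
     (\<forall>i<length qs. d (qs ! i) \<le> i + 1) \<and>
     (\<forall>i<length qs. \<forall>i'<i. d (qs ! i') \<le> d (qs ! i)) \<and>
     d (last qs) \<le> d (qs ! (k - 1)) + 1 \<and>
     (\<forall>v<n. d v \<noteq> 0 \<and> v \<noteq> s \<longrightarrow> p v < n \<and> d (p v) \<noteq> 0 \<and> d v = d (p v) + 1 \<and>
        pe v < m \<and> pe v \<notin> X \<and> edge (pe v) = {p v, v}) \<and>
     distinct js \<and> set js \<subseteq> {j \<in> half_edges. src j = qs ! (k - 1)} \<and>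
     (\<forall>j\<in>half_edges. src j \<in> set (take k qs) \<and> j \<notin> set js \<and> eid j \<notin> X \<longrightarrow>
        d (tgt j) \<noteq> 0 \<and> d (tgt j) \<le> d (src j) + 1)"

lemma bfs_inv_init:
  assumes "s < n"
  shows "bfs_inv X s [s] 1 (adj s) ((\<lambda>_. 0)(s := 1)) p pe"
  using assms by (auto simp: bfs_inv_def adj_props)

lemma bfs_inv_labels:
  assumes "bfs_inv X s qs k js d p pe" "i < length qs"
  shows "d (qs ! i) \<noteq> 0 \<and> qs ! i < n"
  using assms nth_mem[OF assms(2)] by (auto simp: bfs_inv_def)

text \<open>Labels never fall along the queue, so the last one bounds them all. This supplies both
  the edge inequality for targets that are already labelled and the order of the queue when a vertex
  is appended.\<close>

lemma bfs_inv_label_le: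
  assumes "bfs_inv X s qs k js d p pe" "v \<in> set qs"
  shows "d v \<le> d (qs ! (k - 1)) + 1"
proof -
  from assms(2) obtain i where i: "i < length qs" "v = qs ! i" by (auto simp: in_set_conv_nth)
  then have "d v \<le> d (last qs)"
  proof (cases "i = length qs - 1")
    case True
    with i show ?thesis by (subst last_conv_nth) auto
  next
    case False
    with i have "i < length qs - 1" by linarith
    with assms(1) i show ?thesis by (subst last_conv_nth) (auto simp: bfs_inv_def)
  qed
  with assms(1) show ?thesis by (auto simp: bfs_inv_def)
qed

lemma bfs_inv_next:
  assumes inv: "bfs_inv X s qs k [] d p pe" and k: "k < length qs"
  shows "bfs_inv X s qs (Suc k) (adj (qs ! k)) d p pe"
proof -
  have "d (qs ! (k - 1)) \<le> d (qs ! k)" using inv k by (auto simp: bfs_inv_def)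
  moreover have "d (last qs) \<le> d (qs ! (k - 1)) + 1" using inv by (auto simp: bfs_inv_def)
  ultimately have 1: "d (last qs) \<le> d (qs ! k) + 1" by linarith
  have 2: "set (take (Suc k) qs) = insert (qs ! k) (set (take k qs))"
    using k by (simp add: take_Suc_conv_app_nth)
  show ?thesis using inv k 1 unfolding bfs_inv_def 2 by (auto simp: adj_props)
qed

lemma bfs_inv_skip:
  assumes inv: "bfs_inv X s qs k (j # js) d p pe" and j: "eid j \<in> X \<or> d (tgt j) \<noteq> 0"
  shows "bfs_inv X s qs k js d p pe"
proof -
  have je: "j \<in> half_edges" "src j = qs ! (k - 1)" using inv by (auto simp: bfs_inv_def)
  have "d (tgt j) \<noteq> 0 \<and> d (tgt j) \<le> d (src j) + 1" if "eid j \<notin> X"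
  proof -
    from j that have "d (tgt j) \<noteq> 0" by blast
    moreover from this have "tgt j \<in> set qs" using inv half_edge[OF je(1)] by (auto simp: bfs_inv_def)
    ultimately show ?thesis using bfs_inv_label_le[OF inv] je by simp
  qed
  moreover have "distinct js" "set js \<subseteq> {j \<in> half_edges. src j = qs ! (k - 1)}"
    using inv by (auto simp: bfs_inv_def)
  ultimately show ?thesis using inv unfolding bfs_inv_def by auto
qed

text \<open>The new label \<open>d u + 1\<close> is at least every label in the queue, so the order
  is kept. As \<open>w\<close> had no label before, it is neither an old parent nor the target of a
  scanned live half-edge, so the older facts are unaffected.\<close>

lemma bfs_inv_visit:
  assumes inv: "bfs_inv X s qs k (j # js) d p pe" and j: "eid j \<notin> X" "d (tgt j) = 0"
  defines "u \<equiv> qs ! (k - 1)"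
  shows "bfs_inv X s (qs @ [tgt j]) k js
    (d(tgt j := d u + 1)) (p(tgt j := u)) (pe(tgt j := eid j))"
proof -
  define w where "w = tgt j"
  have je: "j \<in> half_edges" "src j = u" using inv by (auto simp: bfs_inv_def u_def)
  note h = half_edge[OF je(1), folded w_def, unfolded je(2)]
  have k: "1 \<le> k" "k \<le> length qs" and ds: "s < n" "d s = 1" and dist: "distinct qs"
    and qs: "set qs = {v. v < n \<and> d v \<noteq> 0}"
    and pos: "\<And>i. i < length qs \<Longrightarrow> d (qs ! i) \<le> i + 1"
    and srt: "\<And>i i'. i < length qs \<Longrightarrow> i' < i \<Longrightarrow> d (qs ! i') \<le> d (qs ! i)"
    and par: "\<And>v. v < n \<Longrightarrow> d v \<noteq> 0 \<Longrightarrow> v \<noteq> s \<Longrightarrow> p v < n \<and> d (p v) \<noteq> 0 \<and> d v = d (p v) + 1 \<and>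
        pe v < m \<and> pe v \<notin> X \<and> edge (pe v) = {p v, v}"
    and js: "distinct (j # js)" "set (j # js) \<subseteq> {j \<in> half_edges. src j = u}"
    and scanned: "\<And>j'. j' \<in> half_edges \<Longrightarrow> src j' \<in> set (take k qs) \<Longrightarrow> j' \<notin> set (j # js) \<Longrightarrow> eid j' \<notin> X \<Longrightarrow>
        d (tgt j') \<noteq> 0 \<and> d (tgt j') \<le> d (src j') + 1"
    using inv unfolding bfs_inv_def u_def by (elim conjE; blast)+
  have w0: "d w = 0" using j by (simp add: w_def)
  have wq: "w \<notin> set qs" using qs w0 by auto
  have u: "u \<in> set qs" using k by (simp add: u_def)
  with qs have du: "d u \<noteq> 0" "u < n" by auto
  have uw: "u \<noteq> w" using wq u by auto
  have ws: "w \<noteq> s" using w0 ds by auto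
  let ?d = "d(w := d u + 1)" and ?qs = "qs @ [w]"
  have old: "?d v = d v" if "v \<in> set qs" for v using that wq by auto
  have oldi: "?d (?qs ! i) = d (qs ! i)" if "i < length qs" for i
    using that old[of "qs ! i"] by (simp add: nth_append)
  have k1: "k - 1 < length qs" using k by linarith
  then have ui: "?qs ! (k - 1) = u" unfolding nth_append u_def by simp
  have "?d s = 1" using ds ws by simp
  moreover have "distinct ?qs" using dist wq by simp
  moreover have "set ?qs = {v. v < n \<and> ?d v \<noteq> 0}" using qs h by auto
  \<comment> \<open>This part of the invariant bounds all distances by \<open>n\<close>, and thereby
    the time for pushing a path onto the stack.\<close>
  moreover have "\<forall>i<length ?qs. ?d (?qs ! i) \<le> i + 1"
  proof (intro allI impI)
    fix i assume "i < length ?qs"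
    then consider "i < length qs" | "i = length qs" by fastforce
    then show "?d (?qs ! i) \<le> i + 1"
    proof cases
      case 1
      then show ?thesis using oldi pos by simp
    next
      case 2
      then show ?thesis using pos[OF k1] k by (simp add: u_def)
    qed
  qed
  moreover have "\<forall>i<length ?qs. \<forall>i'<i. ?d (?qs ! i') \<le> ?d (?qs ! i)"
  proof (intro allI impI)
    fix i i' assume i: "i < length ?qs" "i' < i"
    then consider "i < length qs" | "i = length qs" by fastforce
    then show "?d (?qs ! i') \<le> ?d (?qs ! i)"
    proof cases
      case 1
      then show ?thesis using oldi[of i] oldi[of i'] srt i by simp
    next
      case 2
      with i have "?d (?qs ! i') = d (qs ! i')" using oldi by simp
      with 2 i show ?thesis using bfs_inv_label_le[OF inv, of "qs ! i'"] by (simp add: u_def)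
    qed
  qed
  moreover have "?d (last ?qs) \<le> ?d (?qs ! (k - 1)) + 1" using ui uw by simp
  moreover have "\<forall>v<n. ?d v \<noteq> 0 \<and> v \<noteq> s \<longrightarrow> (p(w := u)) v < n \<and> ?d ((p(w := u)) v) \<noteq> 0 \<and>
      ?d v = ?d ((p(w := u)) v) + 1 \<and> (pe(w := eid j)) v < m \<and> (pe(w := eid j)) v \<notin> X \<and>
      edge ((pe(w := eid j)) v) = {(p(w := u)) v, v}"
  proof (intro allI impI)
    fix v assume v: "v < n" "?d v \<noteq> 0 \<and> v \<noteq> s"
    show "(p(w := u)) v < n \<and> ?d ((p(w := u)) v) \<noteq> 0 \<and>
      ?d v = ?d ((p(w := u)) v) + 1 \<and> (pe(w := eid j)) v < m \<and> (pe(w := eid j)) v \<notin> X \<and>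
      edge ((pe(w := eid j)) v) = {(p(w := u)) v, v}"
    proof (cases "v = w")
      case True
      then show ?thesis using h j du uw by simp
    next
      case False
      with v par[of v] have *: "p v < n \<and> d (p v) \<noteq> 0 \<and> d v = d (p v) + 1 \<and>
        pe v < m \<and> pe v \<notin> X \<and> edge (pe v) = {p v, v}" by auto
      with w0 have "p v \<noteq> w" by metis
      with * False show ?thesis by simp
    qed
  qed
  moreover have "distinct js" "set js \<subseteq> {j \<in> half_edges. src j = ?qs ! (k - 1)}"
    using js unfolding ui by auto
  moreover have "\<forall>j'\<in>half_edges. src j' \<in> set (take k ?qs) \<and> j' \<notin> set js \<and> eid j' \<notin> X \<longrightarrow>
        ?d (tgt j') \<noteq> 0 \<and> ?d (tgt j') \<le> ?d (src j') + 1"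
  proof (intro ballI impI)
    fix j' assume j': "j' \<in> half_edges" "src j' \<in> set (take k ?qs) \<and> j' \<notin> set js \<and> eid j' \<notin> X"
    then have st: "src j' \<in> set (take k qs)" using k by simp
    then have sw: "src j' \<in> set qs" by (rule in_set_takeD)
    show "?d (tgt j') \<noteq> 0 \<and> ?d (tgt j') \<le> ?d (src j') + 1"
    proof (cases "j' = j")
      case True
      then show ?thesis using je uw w_def by simp
    next
      case False
      with scanned[OF j'(1) st] j' have *: "d (tgt j') \<noteq> 0 \<and> d (tgt j') \<le> d (src j') + 1" by auto
      with w0 have "tgt j' \<noteq> w" by metis
      with * old[OF sw] show ?thesis by simp
    qed
  qed
  moreover have "k \<le> length ?qs" using k by simp
  ultimately show ?thesis unfolding bfs_inv_def w_def[symmetric] using ds(1) k(1) by blast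
qed

lemma bfs_inv_final:
  assumes inv: "bfs_inv X s qs (length qs) [] d p pe"
  shows "dist_labels {..<n} (live X) s d p"
proof
  show "s \<in> {..<n}" "d s = 1" using inv by (auto simp: bfs_inv_def)
next
  fix v assume "v \<in> {..<n}" "d v \<noteq> 0" "v \<noteq> s"
  with inv have *: "p v < n \<and> d (p v) \<noteq> 0 \<and> d v = d (p v) + 1 \<and>
        pe v < m \<and> pe v \<notin> X \<and> edge (pe v) = {p v, v}" by (auto simp: bfs_inv_def)
  with edge_in_live_iff[of "pe v" X]
  show "p v \<in> {..<n} \<and> d (p v) \<noteq> 0 \<and> d v = d (p v) + 1 \<and> {p v, v} \<in> live X" by auto
next
  fix u w assume *: "u \<in> {..<n}" "w \<in> {..<n}" "{u, w} \<in> live X" "d u \<noteq> 0"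
  then obtain i where i: "i < m" "i \<notin> X" "edge i = {u, w}" by (auto simp: live_def)
  obtain j where j: "j \<in> half_edges" "eid j = i" "src j = u" "tgt j = w"
    using half_edge_of_edge[OF i(1,3)] .
  moreover have "u \<in> set qs" using inv * by (auto simp: bfs_inv_def)
  moreover have "\<forall>j\<in>half_edges. src j \<in> set qs \<and> eid j \<notin> X \<longrightarrow>
      d (tgt j) \<noteq> 0 \<and> d (tgt j) \<le> d (src j) + 1"
    using inv by (simp add: bfs_inv_def)
  ultimately show "d w \<noteq> 0 \<and> d w \<le> d u + 1" using i by blast
qed

lemma bfs_inv_branching:
  assumes inv: "bfs_inv X s qs (length qs) [] d p pe" and "X \<subseteq> {..m}" "t < n" "d t = Suc D"
  shows "branching n es X s d p pe t D"
proof -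
  interpret dist_labels "{..<n}" "live X" s d p by (rule bfs_inv_final[OF inv])
  show ?thesis by unfold_locales (use assms in \<open>auto simp: bfs_inv_def\<close>)
qed

lemma bfs_inv_length: "bfs_inv X s qs k js d p pe \<Longrightarrow> length qs \<le> n"
proof -
  assume inv: "bfs_inv X s qs k js d p pe"
  then have "length qs = card (set qs)" "set qs \<subseteq> {..<n}"
    by (auto simp: bfs_inv_def distinct_card[symmetric])
  then show ?thesis using card_mono[of "{..<n}" "set qs"] by simp
qed

text \<open>The final queue consists of the reached vertices, each once, so one comparison of its
  length tests connectivity.\<close>

lemma bfs_inv_connected:
  assumes inv: "bfs_inv X s qs (length qs) [] d p pe"
  shows "length qs = n \<longleftrightarrow> graph_connected {..<n} (live X)"
proof -
  interpret dist_labels "{..<n}" "live X" s d p by (rule bfs_inv_final[OF inv])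
  have *: "length qs = card (set qs)" "set qs = {v. v < n \<and> d v \<noteq> 0}"
    using inv by (auto simp: bfs_inv_def distinct_card[symmetric])
  have "length qs = n \<longleftrightarrow> set qs = {..<n}"
  proof
    assume "length qs = n"
    with * show "set qs = {..<n}" by (intro card_subset_eq) auto
  qed (use * in simp)
  then show ?thesis unfolding connected_iff *(2) by auto
qed

end

section \<open>The program\<close>

abbreviation (input) Var :: "nat \<Rightarrow> aexp" where "Var a \<equiv> Read a (Const 0)"

abbreviation (input) Assign :: "nat \<Rightarrow> aexp \<Rightarrow> com"  (infix "::=" 61) where
  "a ::= e \<equiv> Write a (Const 0) e"

abbreviation (input) Then :: "com \<Rightarrow> com \<Rightarrow> com"  (infixr ";;" 60) where
  "c1 ;; c2 \<equiv> Seq c1 c2"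

abbreviation (input) Succ :: "aexp \<Rightarrow> aexp" where "Succ e \<equiv> Add e (Const 1)"

abbreviation (input) input_array :: nat where "input_array \<equiv> 0"
abbreviation (input) answer_array :: nat where "answer_array \<equiv> 1"
abbreviation (input) head :: nat where "head \<equiv> 2"
abbreviation (input) nxt :: nat where "nxt \<equiv> 3"
abbreviation (input) target :: nat where "target \<equiv> 4"
abbreviation (input) edge_id :: nat where "edge_id \<equiv> 5"
abbreviation (input) deleted :: nat where "deleted \<equiv> 6"
abbreviation (input) stack :: nat where "stack \<equiv> 7"
abbreviation (input) queue :: nat where "queue \<equiv> 8"
abbreviation (input) label :: nat where "label \<equiv> 9"
abbreviation (input) parent :: nat where "parent \<equiv> 10"
abbreviation (input) parent_eid :: nat where "parent_eid \<equiv> 11"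

abbreviation (input) half :: nat where "half \<equiv> 12"
abbreviation (input) counter :: nat where "counter \<equiv> 13"
abbreviation (input) source :: nat where "source \<equiv> 14"
abbreviation (input) sink :: nat where "sink \<equiv> 15"
abbreviation (input) budget :: nat where "budget \<equiv> 16"
abbreviation (input) stack_size :: nat where "stack_size \<equiv> 17"
abbreviation (input) item :: nat where "item \<equiv> 18"
abbreviation (input) current :: nat where "current \<equiv> 19"
abbreviation (input) queue_head :: nat where "queue_head \<equiv> 20"
abbreviation (input) queue_tail :: nat where "queue_tail \<equiv> 21"
abbreviation (input) vertex :: nat where "vertex \<equiv> 22"

abbreviation (input) "num_vertices \<equiv> Read input_array (Const 0)"
abbreviation (input) "num_edges \<equiv> Read input_array (Const 1)"
abbreviation (input) "input_k \<equiv> Read input_array (Const 2)"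
abbreviation (input) "input_l \<equiv> Read input_array (Const 3)"

text \<open>The machine neither multiplies nor divides: \<open>half\<close> advances by 2 per edge
  in place of computing \<open>2 * i + 2\<close>, and the table \<open>edge_id\<close> replaces the
  division in \<open>eid\<close>.\<close>

definition build_step :: com where
  "build_step =
    Write target (Var half) (Read input_array (Add (Var half) (Const 3)));;
    Write target (Succ (Var half)) (Read input_array (Add (Var half) (Const 2)));;
    Write edge_id (Var half) (Var counter);;
    Write edge_id (Succ (Var half)) (Var counter);;
    Write nxt (Var half) (Read head (Read input_array (Add (Var half) (Const 2))));;
    Write head (Read input_array (Add (Var half) (Const 2))) (Var half);;
    Write nxt (Succ (Var half)) (Read head (Read input_array (Add (Var half) (Const 3))));;
    Write head (Read input_array (Add (Var half) (Const 3))) (Succ (Var half));;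
    half ::= Add (Var half) (Const 2);;
    counter ::= Succ (Var counter)"

definition build :: com where
  "build = half ::= Const 2;; Loop (Less (Var counter) num_edges) build_step"

definition reset_step :: com where
  "reset_step = Write label (Var counter) (Const 0);; counter ::= Succ (Var counter)"

text \<open>The nested loops over the queue and over an adjacency list are merged into one. Each
  iteration either takes a vertex out of the queue or scans one half-edge, so the costs simply add
  up.\<close>

definition scan_step :: com where
  "scan_step =
    Cond (Equal (Var half) (Const 0))
     (current ::= Read queue (Var queue_head);;
      queue_head ::= Succ (Var queue_head);;
      half ::= Read head (Var current))
     (vertex ::= Read target (Var half);;
      Cond (Conj (Equal (Read deleted (Read edge_id (Var half))) (Const 0))
                 (Equal (Read label (Var vertex)) (Const 0)))
       (Write label (Var vertex) (Succ (Read label (Var current)));;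
        Write parent (Var vertex) (Var current);;
        Write parent_eid (Var vertex) (Read edge_id (Var half));;
        Write queue (Var queue_tail) (Var vertex);;
        queue_tail ::= Succ (Var queue_tail))
       Skip;;
      half ::= Read nxt (Var half))"

definition scan :: com where
  "scan =
    Loop (Neg (Conj (Equal (Var half) (Const 0)) (Equal (Var queue_head) (Var queue_tail)))) scan_step"

text \<open>The source enters and leaves the queue at once, hence \<open>queue_head\<close> starts
  at 1 and there is always a current vertex.\<close>

definition bfs_init :: com where
  "bfs_init =
    Write label (Var source) (Const 1);;
    Write queue (Const 0) (Var source);;
    queue_head ::= Const 1;;
    queue_tail ::= Const 1;;
    current ::= Var source;;
    half ::= Read head (Var source)"

definition bfs :: com where
  "bfs =
    counter ::= Const 0;;
    Loop (Less (Var counter) num_vertices) reset_step;;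
    bfs_init;;
    scan"

definition push_step :: com where
  "push_step =
    Write stack (Var stack_size) (Read parent_eid (Var vertex));;
    stack_size ::= Succ (Var stack_size);;
    vertex ::= Read parent (Var vertex)"

definition push_path :: com where
  "push_path =
    vertex ::= Var sink;;
    Loop (Neg (Equal (Var vertex) (Var source))) push_step"

text \<open>An item \<open>e \<ge> 0\<close> on the stack asks for the deletion of edge \<open>e\<close> and for the search below
  that deletion, and \<open>- 1 - e\<close> asks for the restoration of edge \<open>e\<close>.\<close>

definition pop_item :: com where
  "pop_item =
    stack_size ::= Sub (Var stack_size) (Const 1);;
    item ::= Read stack (Var stack_size)"

definition restore_item :: com where
  "restore_item =
    Write deleted (Sub (Const (- 1)) (Var item)) (Const 0);;
    budget ::= Succ (Var budget)"

definition delete_item :: com where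
  "delete_item =
    Write deleted (Var item) (Const 1);;
    budget ::= Sub (Var budget) (Const 1);;
    Write stack (Var stack_size) (Sub (Const (- 1)) (Var item));;
    stack_size ::= Succ (Var stack_size)"

text \<open>A success does not end the search: the remaining items must still be processed so that
  every deletion is undone.\<close>

definition branch :: com where
  "branch =
    Cond (Equal (Var queue_tail) num_vertices)
     (Cond (Less (Sub (Read label (Var sink)) (Const 1)) input_l)
       (Cond (Less (Const 0) (Var budget)) push_path Skip)
       (answer_array ::= Const 1))
     Skip"

definition visit :: com where
  "visit = pop_item;; Cond (Less (Var item) (Const 0)) restore_item (delete_item;; bfs;; branch)"

definition search :: com where
  "search = Loop (Less (Const 0) (Var stack_size)) visit"

text \<open>The root item is the dummy index \<open>m\<close>. Its deletion consumes one unit, hence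
  the budget \<open>k + 1\<close>, and marks a cell to which no half-edge refers.\<close>

definition pair_step :: com where
  "pair_step =
    budget ::= Succ input_k;;
    Write stack (Const 0) num_edges;;
    stack_size ::= Const 1;;
    search;;
    sink ::= Succ (Var sink);;
    Cond (Equal (Var sink) num_vertices)
     (sink ::= Const 0;; source ::= Succ (Var source))
     Skip"

definition decide :: com where
  "decide =
    build;;
    Cond (Less input_k (Const 0)) Skip (Loop (Less (Var source) num_vertices) pair_step)"

section \<open>Adjacency lists in memory\<close>

primrec linked :: "(int \<Rightarrow> int) \<Rightarrow> int \<Rightarrow> nat list \<Rightarrow> bool" where
  "linked nx a [] \<longleftrightarrow> a = 0"
| "linked nx a (j # js) \<longleftrightarrow> a = int j \<and> j \<noteq> 0 \<and> linked nx (nx a) js"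

lemma linked_upd: "int j \<notin> int ` set js \<Longrightarrow> linked (nx(int j := x)) a js \<longleftrightarrow> linked nx a js"
  by (induction js arbitrary: a) auto

context edge_list
begin

text \<open>What is fixed once \<open>build\<close> has finished and is only read from then
  on.\<close>

definition tables :: "int \<Rightarrow> int \<Rightarrow> mem \<Rightarrow> bool" where
  "tables k l M \<longleftrightarrow>
     M input_array 0 = int n \<and> M input_array 1 = int m \<and> M input_array 2 = k \<and> M input_array 3 = l \<and>
     (\<forall>j\<in>half_edges. M target (int j) = int (tgt j) \<and> M edge_id (int j) = int (eid j)) \<and>
     (\<forall>v<n. linked (M nxt) (M head (int v)) (adj v))"

definition adj_upto :: "nat \<Rightarrow> nat \<Rightarrow> nat list" where
  "adj_upto a v = rev (filter (\<lambda>j. src j = v) [2..<a])"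

lemma adj_upto_Suc:
  "2 \<le> a \<Longrightarrow> adj_upto (Suc a) v = (if src a = v then a # adj_upto a v else adj_upto a v)"
  by (simp add: adj_upto_def)

definition chained :: "(int \<Rightarrow> int) \<Rightarrow> (int \<Rightarrow> int) \<Rightarrow> nat \<Rightarrow> bool" where
  "chained h nx a \<longleftrightarrow> (\<forall>v<n. linked nx (h (int v)) (adj_upto a v))"

text \<open>All half-edges listed so far are smaller than \<open>a\<close>, so writing the successor
  cell of \<open>a\<close> disturbs no existing list.\<close>

lemma chained_Suc:
  assumes "2 \<le> a" "chained h nx a" "x = int a" "y = int (src a)"
  shows "chained (h(y := x)) (nx(x := h y)) (Suc a)"
  unfolding chained_def
proof (intro allI impI)
  fix v assume v: "v < n"
  have "a \<notin> set (adj_upto a w)" for w by (simp add: adj_upto_def)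
  then have "int a \<notin> int ` set (adj_upto a w)" for w by auto
  with assms v show "linked (nx(x := h y)) ((h(y := x)) (int v)) (adj_upto (Suc a) v)"
    by (auto simp: adj_upto_Suc linked_upd chained_def)
qed

lemma input_nth:
  assumes "i < m"
  shows "(concat (map (\<lambda>(u, v). [int u, int v]) es)) ! (2 * i) = int (fst (es ! i))"
    "(concat (map (\<lambda>(u, v). [int u, int v]) es)) ! (2 * i + 1) = int (snd (es ! i))"
proof -
  have "i < length es \<Longrightarrow> (concat (map (\<lambda>(u, v). [int u, int v]) es)) ! (2 * i) = int (fst (es ! i)) \<and>
    (concat (map (\<lambda>(u, v). [int u, int v]) es)) ! (2 * i + 1) = int (snd (es ! i))" for es :: "(nat \<times> nat) list"
  proof (induction es arbitrary: i)
    case (Cons e es)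
    then show ?case by (cases i; cases e) auto
  qed simp
  with assms show "(concat (map (\<lambda>(u, v). [int u, int v]) es)) ! (2 * i) = int (fst (es ! i))"
    "(concat (map (\<lambda>(u, v). [int u, int v]) es)) ! (2 * i + 1) = int (snd (es ! i))"
    unfolding m_def by blast+
qed

lemma length_input: "length (concat (map (\<lambda>(u, v). [int u, int v]) es)) = 2 * m"
  unfolding m_def by (induction es) auto

lemma load_encode:
  shows "load (encode n es k l) 0 0 = int n" "load (encode n es k l) 0 1 = int m"
    "load (encode n es k l) 0 2 = k" "load (encode n es k l) 0 3 = l"
    "i < m \<Longrightarrow> load (encode n es k l) 0 (2 * int i + 4) = int (fst (es ! i))"
    "i < m \<Longrightarrow> load (encode n es k l) 0 (2 * int i + 5) = int (snd (es ! i))"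
    "a \<noteq> 0 \<Longrightarrow> load (encode n es k l) a = (\<lambda>_. 0)"
proof -
  show "load (encode n es k l) 0 0 = int n" "load (encode n es k l) 0 1 = int m"
    "load (encode n es k l) 0 2 = k" "load (encode n es k l) 0 3 = l"
    by (simp_all add: load_def encode_def m_def nth_append)
  show "a \<noteq> 0 \<Longrightarrow> load (encode n es k l) a = (\<lambda>_. 0)" by (auto simp: load_def)
  assume i: "i < m"
  have "nat (2 * int i + 4) = 2 * i + 4" "nat (2 * int i + 5) = 2 * i + 5" by linarith+
  then show "load (encode n es k l) 0 (2 * int i + 4) = int (fst (es ! i))"
    "load (encode n es k l) 0 (2 * int i + 5) = int (snd (es ! i))"
    using i input_nth[OF i] length_input
    by (simp_all add: load_def encode_def)
qed

lemma build_correct: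
  "terminates build (110 * m + 20) (\<lambda>M. tables k l M \<and>
     (\<forall>a. a \<notin> writes build \<longrightarrow> M a = load (encode n es k l) a)) (load (encode n es k l))"
proof -
  let ?L = "load (encode n es k l)"
  \<comment> \<open>Each iteration is granted 110 units: 100 for the body and 6 for the test,
    rounded up. The other time constants are rounded just as generously.\<close>
  define I where "I = (\<lambda>T M. \<exists>i\<le>m. T = 110 * (m - i) + 10 \<and> M input_array = ?L input_array \<and>
    M half 0 = 2 * int i + 2 \<and> M counter 0 = int i \<and>
    (\<forall>j\<in>{2..<2 * i + 2}. M target (int j) = int (tgt j) \<and> M edge_id (int j) = int (eid j)) \<and>
    chained (M head) (M nxt) (2 * i + 2))"
  let ?b = "Less (Var counter) num_edges"
  have step: "terminates build_step 100 (\<lambda>M'. \<exists>T'. I T' M' \<and> bcost ?b + 100 + 1 + T' \<le> T) M"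
    if inv: "I T M" and b: "bval ?b M" for T M
  proof (rule terminates_run)
    from inv obtain i where i: "i \<le> m" and T: "T = 110 * (m - i) + 10"
      and M: "M input_array = ?L input_array" "M half 0 = 2 * int i + 2" "M counter 0 = int i"
      and tab: "\<forall>j\<in>{2..<2 * i + 2}. M target (int j) = int (tgt j) \<and> M edge_id (int j) = int (eid j)"
      and lnk: "chained (M head) (M nxt) (2 * i + 2)"
      unfolding I_def by blast
    from b M load_encode have im: "i < m" by simp
    let ?j = "2 * i + 2" and ?u = "fst (es ! i)" and ?v = "snd (es ! i)" and ?M = "run build_step M"
    have su: "src ?j = ?u" "tgt ?j = ?v" "eid ?j = i" "src (Suc ?j) = ?v" "tgt (Suc ?j) = ?u"
      "eid (Suc ?j) = i"
      by (simp_all add: src_def tgt_def eid_def)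
    have uv: "?u \<noteq> ?v" using edge_ends[OF im] by simp
    have rd: "?L 0 (4 + 2 * int i) = int ?u" "?L 0 (5 + 2 * int i) = int ?v"
      using load_encode(5,6)[OF im] by (simp_all add: add.commute)
    \<comment> \<open>Two insertions, one for each orientation of edge \<open>i\<close>.\<close>
    note lnk2 = chained_Suc[OF _ chained_Suc[OF _ lnk, of "2 * int i + 2" "int ?u"],
        of "2 * int i + 2 + 1" "int ?v"]
    have run: "?M input_array = ?L input_array" "?M half 0 = 2 * int (Suc i) + 2" "?M counter 0 = int (Suc i)"
      "?M target = (M target)(2 * int i + 2 := int ?v, 2 * int i + 2 + 1 := int ?u)"
      "?M edge_id = (M edge_id)(2 * int i + 2 := int i, 2 * int i + 2 + 1 := int i)"
      "?M head = (M head)(int ?u := 2 * int i + 2, int ?v := 2 * int i + 2 + 1)"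
      "?M nxt = (M nxt)(2 * int i + 2 := M head (int ?u), 2 * int i + 2 + 1 := ((M head)(int ?u := 2 * int i + 2)) (int ?v))"
      unfolding build_step_def using uv
      by (simp_all add: M rd del: add.assoc)
    show "loop_free build_step" "max_cost build_step \<le> 100" by (simp_all add: build_step_def)
    have tab2: "\<forall>j'\<in>{2..<2 * Suc i + 2}. ?M target (int j') = int (tgt j') \<and> ?M edge_id (int j') = int (eid j')"
    proof
      fix j' assume "j' \<in> {2..<2 * Suc i + 2}"
      then consider "j' \<in> {2..<2 * i + 2}" | "j' = ?j" | "j' = Suc ?j" by fastforce
      then show "?M target (int j') = int (tgt j') \<and> ?M edge_id (int j') = int (eid j')"
        unfolding run using tab su by cases auto
    qed
    have "2 * Suc i + 2 = Suc (Suc ?j)" by simp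
    then have "chained (?M head) (?M nxt) (2 * Suc i + 2)"
      unfolding run by (simp only:) (rule lnk2; simp only: su | simp)
    with run tab2 im show "\<exists>T'. I T' ?M \<and> bcost ?b + 100 + 1 + T' \<le> T"
      unfolding I_def T by (intro exI[of _ "110 * (m - Suc i) + 10"] conjI exI[of _ "Suc i"]) auto
  qed
  have "terminates build (110 * m + 20) (tables k l) ?L"
    unfolding build_def
  proof (rule terminates_Seq)
    show "terminates (half ::= Const 2) 5 (I (110 * m + 10)) ?L"
    proof (rule terminates_run)
      \<comment> \<open>Memory starts at 0, which is the end marker, so all lists are empty without
        initialisation.\<close>
      have "chained (\<lambda>_. 0) (\<lambda>_. 0) (Suc (Suc 0))" by (simp add: chained_def adj_upto_def)
      then show "I (110 * m + 10) (run (half ::= Const 2) ?L)"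
        unfolding I_def by (intro exI[of _ 0]) (simp add: load_encode)
    qed simp_all
    show "terminates (Loop ?b build_step) (110 * m + 10) (tables k l) M" if "I (110 * m + 10) M" for M
    proof (rule terminates_Loop[where I = I and B = 100, OF that step])
      fix T M assume "I T M" "\<not> bval ?b M"
      then obtain i where i: "i \<le> m" and T: "T = 110 * (m - i) + 10"
        and M: "M input_array = ?L input_array" "M half 0 = 2 * int i + 2" "M counter 0 = int i"
        and tab: "\<forall>j\<in>{2..<2 * i + 2}. M target (int j) = int (tgt j) \<and> M edge_id (int j) = int (eid j)"
        and lnk: "chained (M head) (M nxt) (2 * i + 2)" and b: "\<not> bval ?b M"
        unfolding I_def by blast
      from b M load_encode i have im: "i = m" by simp
      with M tab lnk have "tables k l M"
        unfolding tables_def by (simp add: load_encode half_edges_def chained_def adj_def adj_upto_def)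
      with T show "bcost ?b + 1 \<le> T \<and> tables k l M" by simp
    qed
  qed simp
  then show ?thesis by (rule terminates_frame)
qed

section \<open>Correctness and running time of the search\<close>

text \<open>The potential for the running time: the half-edges that may still have to be scanned,
  including those out of vertices that are not yet, or never, reached.\<close>

definition unscanned :: "nat list \<Rightarrow> nat \<Rightarrow> nat list \<Rightarrow> nat set" where
  "unscanned qs k js = {j \<in> half_edges. src j \<notin> set (take k qs)} \<union> set js"

text \<open>The half-edges out of the next vertex only move from one part of the union to the other.
  Taking a vertex out is therefore paid for by \<open>n - k\<close> alone.\<close>

lemma unscanned_next:
  assumes "bfs_inv X s qs k [] d p pe" "k < length qs"
  shows "unscanned qs (Suc k) (adj (qs ! k)) = unscanned qs k []"
proof -
  have "qs ! k \<notin> set (take k qs)"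
    using assms by (auto simp: bfs_inv_def in_set_conv_nth nth_eq_iff_index_eq)
  then show ?thesis
    using assms(2) by (auto simp: unscanned_def adj_props take_Suc_conv_app_nth)
qed

lemma unscanned_scan:
  assumes "bfs_inv X s qs k (j # js) d p pe"
  shows "card (unscanned qs k (j # js)) = Suc (card (unscanned qs k js))"
proof -
  have "src j = qs ! (k - 1)" "k - 1 < k" "k - 1 < length qs" "j \<notin> set js"
    using assms by (auto simp: bfs_inv_def)
  then have "j \<notin> unscanned qs k js" by (auto simp: unscanned_def in_set_conv_nth)
  moreover have "unscanned qs k (j # js) = insert j (unscanned qs k js)"
    by (auto simp: unscanned_def)
  moreover have "finite (unscanned qs k js)" by (simp add: unscanned_def half_edges_def)
  ultimately show ?thesis by simp
qed

text \<open>Only labels are reset between searches, so the parent arrays may hold stale values at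
  the source and at unlabelled vertices.\<close>

definition represents :: "nat \<Rightarrow> mem \<Rightarrow> (nat \<Rightarrow> nat) \<Rightarrow> (nat \<Rightarrow> nat) \<Rightarrow> (nat \<Rightarrow> nat) \<Rightarrow> bool" where
  "represents s M d p pe \<longleftrightarrow>
     (\<forall>v<n. M label (int v) = int (d v) \<and>
        (d v \<noteq> 0 \<and> v \<noteq> s \<longrightarrow> M parent (int v) = int (p v) \<and> M parent_eid (int v) = int (pe v)))"

text \<open>An iteration takes its 100 units either from the vertices still to be taken out or from
  the half-edges still to be scanned. The arrays below 7 hold the input, the answer, the tables and
  the deletion marks.\<close>

definition scan_inv :: "mem \<Rightarrow> nat set \<Rightarrow> nat \<Rightarrow> nat \<Rightarrow> mem \<Rightarrow> bool" where
  "scan_inv M0 X s T M \<longleftrightarrow>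
     (\<exists>qs k js d p pe. bfs_inv X s qs k js d p pe \<and> represents s M d p pe \<and>
        (\<forall>a<7. M a = M0 a) \<and>
        M queue_head 0 = int k \<and> M queue_tail 0 = int (length qs) \<and> linked (M nxt) (M half 0) js \<and>
        M current 0 = int (qs ! (k - 1)) \<and> (\<forall>i<length qs. M queue (int i) = int (qs ! i)) \<and>
        T = 100 * (n - k) + 100 * card (unscanned qs k js) + 20)"

lemma scan_correct:
  assumes tab: "tables k l M" and del: "\<forall>i<m. M deleted (int i) = (if i \<in> X then 1 else 0)"
    and init: "scan_inv M X s T M"
  shows "terminates scan T (\<lambda>M'. \<exists>qs d p pe. bfs_inv X s qs (length qs) [] d p pe \<and> represents s M' d p pe \<and>
     M' queue_tail 0 = int (length qs)) M"
  unfolding scan_def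
proof (rule terminates_Loop[where I = "scan_inv M X s" and B = 60, OF init])
  fix T N
  assume inv: "scan_inv M X s T N"
  let ?b = "Neg (Conj (Equal (Var half) (Const 0)) (Equal (Var queue_head) (Var queue_tail)))"
  from inv obtain qs k' js d p pe where bi: "bfs_inv X s qs k' js d p pe" and rep: "represents s N d p pe"
    and same: "\<forall>a<7. N a = M a"
    and sc: "N queue_head 0 = int k'" "N queue_tail 0 = int (length qs)" "N current 0 = int (qs ! (k' - 1))"
    and lnk: "linked (N nxt) (N half 0) js" and q: "\<forall>i<length qs. N queue (int i) = int (qs ! i)"
    and T: "T = 100 * (n - k') + 100 * card (unscanned qs k' js) + 20"
    unfolding scan_inv_def by blast
  have arr: "N head = M head" "N nxt = M nxt" "N target = M target" "N edge_id = M edge_id" "N deleted = M deleted"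
    using same by simp_all
  have kl: "1 \<le> k'" "k' \<le> length qs" using bi by (auto simp: bfs_inv_def)
  have ln: "length qs \<le> n" by (rule bfs_inv_length[OF bi])
  have j0: "N half 0 = 0 \<longleftrightarrow> js = []" using lnk by (cases js) auto
  have lf: "loop_free scan_step" "max_cost scan_step \<le> 60" by (simp_all add: scan_step_def)
  {
    assume b: "\<not> bval ?b N"
    then have "js = []" "k' = length qs" using j0 sc by auto
    with bi rep sc T
    show "bcost ?b + 1 \<le> T \<and> (\<exists>qs d p pe. bfs_inv X s qs (length qs) [] d p pe \<and> represents s N d p pe \<and>
     N queue_tail 0 = int (length qs))" by auto
  next
    assume b: "bval ?b N"
    show "terminates scan_step 60 (\<lambda>M'. \<exists>T'. scan_inv M X s T' M' \<and> bcost ?b + 60 + 1 + T' \<le> T) N"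
    proof (rule terminates_run[OF lf])
      let ?M = "run scan_step N"
      \<comment> \<open>The common end of the three cases (next vertex, skipped half-edge, new
        vertex): new ghost data whose potential has dropped by 100.\<close>
      have inv': "\<exists>T'. scan_inv M X s T' ?M \<and> bcost ?b + 60 + 1 + T' \<le> T"
        if "bfs_inv X s qs' k'' js' d' p' pe'" "represents s ?M d' p' pe'"
          "?M queue_head 0 = int k''" "?M queue_tail 0 = int (length qs')"
          "linked (M nxt) (?M half 0) js'" "?M current 0 = int (qs' ! (k'' - 1))"
          "\<forall>i<length qs'. ?M queue (int i) = int (qs' ! i)"
          "100 * (n - k'') + 100 * card (unscanned qs' k'' js') + 120 \<le> T"
        for qs' k'' js' d' p' pe'
      proof -
        have "\<forall>a<7. ?M a = M a" using same by (simp add: scan_step_def)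
        with that arr have "scan_inv M X s (100 * (n - k'') + 100 * card (unscanned qs' k'' js') + 20) ?M"
          unfolding scan_inv_def
          by (intro exI[of _ qs'] exI[of _ k''] exI[of _ js'] exI[of _ d'] exI[of _ p'] exI[of _ pe'])
            simp
        with that(8) show ?thesis by (intro exI conjI) auto
      qed
      show "\<exists>T'. scan_inv M X s T' ?M \<and> bcost ?b + 60 + 1 + T' \<le> T"
      proof (cases js)
        case Nil
        with b j0 sc kl have k: "k' < length qs" by auto
        have v: "qs ! k' < n" using bfs_inv_labels[OF bi k] by simp
        have run: "?M = N(current := (N current)(0 := int (qs ! k')),
            queue_head := (N queue_head)(0 := int k' + 1), half := (N half)(0 := M head (int (qs ! k'))))"
          using Nil j0 sc q k arr by (simp add: scan_step_def fun_upd_twist)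
        show ?thesis
        proof (rule inv')
          show "bfs_inv X s qs (Suc k') (adj (qs ! k')) d p pe" using bfs_inv_next[OF _ k] bi Nil by simp
          show "represents s ?M d p pe" using rep by (simp add: run represents_def)
          show "linked (M nxt) (?M half 0) (adj (qs ! k'))" using tab v by (simp add: run tables_def)
          have "card (unscanned qs (Suc k') (adj (qs ! k'))) = card (unscanned qs k' js)"
            using unscanned_next[OF _ k] bi Nil by simp
          with k ln show "100 * (n - Suc k') + 100 * card (unscanned qs (Suc k') (adj (qs ! k'))) + 120 \<le> T"
            unfolding T by simp
        qed (use sc q in \<open>simp_all add: run\<close>)
      next
        case (Cons j js')
        note bi' = bi[unfolded Cons]
        have j: "j \<noteq> 0" "N half 0 = int j" "linked (M nxt) (M nxt (int j)) js'"
          using lnk Cons arr by auto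
        have je: "j \<in> half_edges" using bi' by (auto simp: bfs_inv_def)
        note h = half_edge[OF je]
        have rd: "M target (int j) = int (tgt j)" "M edge_id (int j) = int (eid j)"
          using tab je by (auto simp: tables_def)
        have rd2: "M deleted (int (eid j)) = (if eid j \<in> X then 1 else 0)" using del h by simp
        have rd3: "N label (int (tgt j)) = int (d (tgt j))" using rep h by (simp add: represents_def)
        have u: "qs ! (k' - 1) < n" using bfs_inv_labels[OF bi, of "k' - 1"] kl by simp
        have rd4: "N label (int (qs ! (k' - 1))) = int (d (qs ! (k' - 1)))"
          using rep u by (simp add: represents_def)
        have card: "100 * (n - k') + 100 * card (unscanned qs k' js') + 120 \<le> T"
          unfolding T Cons using unscanned_scan[OF bi'] by simp
        show ?thesis
        proof (cases "eid j \<notin> X \<and> d (tgt j) = 0")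
          case False
          have run: "?M = N(vertex := (N vertex)(0 := int (tgt j)), half := (N half)(0 := M nxt (int j)))"
            using False j rd rd2 rd3 arr by (auto simp: scan_step_def)
          show ?thesis
          proof (rule inv')
            show "bfs_inv X s qs k' js' d p pe" by (rule bfs_inv_skip[OF bi']) (use False in auto)
            show "represents s ?M d p pe" using rep by (simp add: run represents_def)
          qed (use sc q j card in \<open>simp_all add: run\<close>)
        next
          case True
          let ?u = "qs ! (k' - 1)"
          have run: "?M = N(vertex := (N vertex)(0 := int (tgt j)),
              label := (N label)(int (tgt j) := int (d ?u) + 1),
              parent := (N parent)(int (tgt j) := int ?u),
              parent_eid := (N parent_eid)(int (tgt j) := int (eid j)),
              queue := (N queue)(int (length qs) := int (tgt j)),
              queue_tail := (N queue_tail)(0 := int (length qs) + 1),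
              half := (N half)(0 := M nxt (int j)))"
            using True j rd rd2 rd3 rd4 arr sc by (simp add: scan_step_def)
          show ?thesis
          proof (rule inv')
            show "bfs_inv X s (qs @ [tgt j]) k' js' (d(tgt j := d ?u + 1)) (p(tgt j := ?u)) (pe(tgt j := eid j))"
              by (rule bfs_inv_visit[OF bi']) (use True in auto)
            show "represents s ?M (d(tgt j := d ?u + 1)) (p(tgt j := ?u)) (pe(tgt j := eid j))"
              using rep by (simp add: run represents_def)
            have "unscanned (qs @ [tgt j]) k' js' = unscanned qs k' js'" using kl by (simp add: unscanned_def)
            with card show "100 * (n - k') + 100 * card (unscanned (qs @ [tgt j]) k' js') + 120 \<le> T" by simp
            show "\<forall>i<length (qs @ [tgt j]). ?M queue (int i) = int ((qs @ [tgt j]) ! i)"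
              using q by (auto simp: run nth_append less_Suc_eq)
            show "?M current 0 = int ((qs @ [tgt j]) ! (k' - 1))"
              using sc kl by (auto simp: run nth_append)
          qed (use sc j in \<open>simp_all add: run\<close>)
        qed
      qed
    qed
  }
qed

lemma reset_correct:
  assumes "M input_array 0 = int n" "M counter 0 = 0"
  shows "terminates (Loop (Less (Var counter) num_vertices) reset_step) (30 * n + 10)
    (\<lambda>M'. \<forall>v<n. M' label (int v) = 0) M"
proof -
  define I where "I = (\<lambda>T N. \<exists>i\<le>n. T = 30 * (n - i) + 10 \<and> N input_array 0 = int n \<and> N counter 0 = int i \<and>
    (\<forall>v<i. N label (int v) = 0))"
  let ?b = "Less (Var counter) num_vertices"
  show ?thesis
  proof (rule terminates_Loop[where I = I and B = 20])
    show "I (30 * n + 10) M" using assms by (simp add: I_def)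
  next
    fix T N assume "I T N" and b: "bval ?b N"
    then obtain i where i: "i < n" "T = 30 * (n - i) + 10" "N input_array 0 = int n" "N counter 0 = int i"
      "\<forall>v<i. N label (int v) = 0" by (auto simp: I_def)
    show "terminates reset_step 20 (\<lambda>M'. \<exists>T'. I T' M' \<and> bcost ?b + 20 + 1 + T' \<le> T) N"
    proof (rule terminates_run)
      have "I (30 * (n - Suc i) + 10) (run reset_step N)"
        unfolding I_def using i by (intro exI[of _ "Suc i"]) (auto simp: reset_step_def less_Suc_eq)
      with i show "\<exists>T'. I T' (run reset_step N) \<and> bcost ?b + 20 + 1 + T' \<le> T"
        by (intro exI conjI) auto
    qed (simp_all add: reset_step_def)
  next
    fix T N assume "I T N" and b: "\<not> bval ?b N"
    then show "bcost ?b + 1 \<le> T \<and> (\<forall>v<n. N label (int v) = 0)"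
      by (auto simp: I_def)
  qed
qed

text \<open>Per vertex, 30 units reset the label and 100 pay for taking it out of the queue; per
  edge, both half-edges are scanned at most once at 100 units each.\<close>

lemma bfs_correct:
  assumes tab: "tables k l M" and del: "\<forall>i<m. M deleted (int i) = (if i \<in> X then 1 else 0)"
    and s: "M source 0 = int s" "s < n"
  shows "terminates bfs (130 * n + 200 * m + 100) (\<lambda>M'.
     (\<exists>qs d p pe. bfs_inv X s qs (length qs) [] d p pe \<and> represents s M' d p pe \<and>
       M' queue_tail 0 = int (length qs)) \<and> (\<forall>a. a \<notin> writes bfs \<longrightarrow> M' a = M a)) M"
proof (rule terminates_frame)
  let ?Q = "\<lambda>M'. \<exists>qs d p pe. bfs_inv X s qs (length qs) [] d p pe \<and> represents s M' d p pe \<and>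
     M' queue_tail 0 = int (length qs)"
  let ?N = "run (counter ::= Const 0) M"
  let ?loop = "Loop (Less (Var counter) num_vertices) reset_step"
  have 1: "terminates ?loop (30 * n + 10)
      (\<lambda>M'. (\<forall>v<n. M' label (int v) = 0) \<and> (\<forall>a. a \<notin> writes ?loop \<longrightarrow> M' a = ?N a)) ?N"
    by (rule terminates_frame[OF reset_correct]) (use tab in \<open>auto simp: tables_def\<close>)
  have 2: "terminates scan (100 * n + 200 * m + 20) ?Q (run bfs_init N)"
    if "(\<forall>v<n. N label (int v) = 0) \<and> (\<forall>a. a \<notin> writes ?loop \<longrightarrow> N a = ?N a)" for N
  proof (rule terminates_mono)
    let ?M = "run bfs_init N"
    have lab: "\<And>v. v < n \<Longrightarrow> N label (int v) = 0" using that by blast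
    have N: "N a = M a" if "a \<noteq> label" "a \<noteq> counter" for a
      using that \<open>_ \<and> _\<close> by (simp add: reset_step_def)
    have M: "?M = N(label := (N label)(int s := 1), queue := (N queue)(0 := int s),
        queue_head := (N queue_head)(0 := 1), queue_tail := (N queue_tail)(0 := 1),
        current := (N current)(0 := int s), half := (N half)(0 := M head (int s)))"
      using N[of source] N[of head] s by (simp add: bfs_init_def)
    have same: "?M a = M a" if "a < 7" for a using that N[of a] by (simp add: M)
    have tab': "tables k l ?M" using tab same by (simp add: tables_def)
    have del': "\<forall>i<m. ?M deleted (int i) = (if i \<in> X then 1 else 0)" using del same by simp
    have "card (unscanned [s] 1 (adj s)) \<le> card half_edges"
      by (rule card_mono) (auto simp: unscanned_def adj_props half_edges_def)
    then have card: "card (unscanned [s] 1 (adj s)) \<le> 2 * m" by (simp add: half_edges_def)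
    have "scan_inv ?M X s (100 * (n - 1) + 100 * card (unscanned [s] 1 (adj s)) + 20) ?M"
      unfolding scan_inv_def
    proof (intro exI conjI)
      show "bfs_inv X s [s] 1 (adj s) ((\<lambda>_. 0)(s := 1)) (\<lambda>_. 0) (\<lambda>_. 0)"
        by (rule bfs_inv_init[OF s(2)])
      show "represents s ?M ((\<lambda>_. 0)(s := 1)) (\<lambda>_. 0) (\<lambda>_. 0)"
        using lab by (simp add: represents_def M)
      show "linked (?M nxt) (?M half 0) (adj s)"
        using tab s N[of nxt] by (simp add: tables_def M)
    qed (simp_all add: M)
    from scan_correct[OF tab' del' this]
    show "terminates scan (100 * (n - 1) + 100 * card (unscanned [s] 1 (adj s)) + 20) ?Q ?M" .
    show "100 * (n - 1) + 100 * card (unscanned [s] 1 (adj s)) + 20 \<le> 100 * n + 200 * m + 20"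
      using card by simp
  qed
  have 3: "terminates (Seq bfs_init scan) (100 * n + 200 * m + 60) ?Q N"
    if "(\<forall>v<n. N label (int v) = 0) \<and> (\<forall>a. a \<notin> writes ?loop \<longrightarrow> N a = ?N a)" for N
  proof (rule terminates_Seq)
    show "terminates bfs_init 40 (\<lambda>M'. M' = run bfs_init N) N"
      by (rule terminates_run) (simp_all add: bfs_init_def)
    show "terminates scan (100 * n + 200 * m + 20) ?Q N'" if "N' = run bfs_init N" for N'
      using 2 \<open>_ \<and> _\<close> that by simp
  qed simp
  have 4: "terminates (Seq ?loop (Seq bfs_init scan)) (130 * n + 200 * m + 80) ?Q ?N"
    by (rule terminates_Seq[OF 1 3]) simp_all
  show "terminates bfs (130 * n + 200 * m + 100) ?Q M"
    unfolding bfs_def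
  proof (rule terminates_Seq)
    show "terminates (counter ::= Const 0) 5 (\<lambda>M'. M' = ?N) M" by (rule terminates_run) simp_all
    show "terminates (Seq ?loop (Seq bfs_init scan)) (130 * n + 200 * m + 80) ?Q N'" if "N' = ?N" for N'
      using 4 that by simp
  qed simp
qed

section \<open>A single node of the search tree\<close>

text \<open>The top of the stack is the end of \<open>stk\<close>. The range
  \<open>i \<le> m\<close> includes the mark of the dummy index.\<close>

definition search_state ::
  "int \<Rightarrow> int \<Rightarrow> nat \<Rightarrow> nat \<Rightarrow> nat set \<Rightarrow> nat \<Rightarrow> int list \<Rightarrow> bool \<Rightarrow> mem \<Rightarrow> bool" where
  "search_state k l s t X r stk f M \<longleftrightarrow>
     tables k l M \<and> (\<forall>i\<le>m. M deleted (int i) = (if i \<in> X then 1 else 0)) \<and>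
     M source 0 = int s \<and> M sink 0 = int t \<and> M budget 0 = int r \<and>
     M stack_size 0 = int (length stk) \<and> (\<forall>i<length stk. M stack (int i) = stk ! i) \<and>
     M answer_array 0 = (if f then 1 else 0)"

lemma push_correct:
  assumes "branching n es X s d p pe t D" and rep: "represents s M d p pe"
    and M: "M source 0 = int s" "M sink 0 = int t" "M stack_size 0 = int (length stk)"
      "\<forall>i<length stk. M stack (int i) = stk ! i"
  shows "terminates push_path (40 * D + 20) (\<lambda>M'.
    (M' stack_size 0 = int (length stk + D) \<and>
     (\<forall>i<length stk + D. M' stack (int i) = (stk @ map int (branching.branches p pe t D)) ! i)) \<and>
    (\<forall>a. a \<notin> writes push_path \<longrightarrow> M' a = M a)) M"
proof (rule terminates_frame)
  interpret branching n es X s d p pe t D by fact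
  let ?stk = "stk @ map int branches"
  let ?v = "\<lambda>i. (p ^^ i) t"
  define I where "I = (\<lambda>T N. \<exists>i\<le>D. T = 40 * (D - i) + 10 \<and> N vertex 0 = int (?v i) \<and>
    N stack_size 0 = int (length stk + i) \<and> (\<forall>i'<length stk + i. N stack (int i') = ?stk ! i') \<and>
    N source = M source \<and> N parent = M parent \<and> N parent_eid = M parent_eid)"
  let ?b = "Neg (Equal (Var vertex) (Var source))"
  let ?Q = "\<lambda>N. N stack_size 0 = int (length stk + D) \<and> (\<forall>i<length stk + D. N stack (int i) = ?stk ! i)"
  \<comment> \<open>The chain of parents meets \<open>s\<close> at step \<open>D\<close> and not
    earlier, so the loop pushes exactly \<open>D\<close> edges.\<close>
  have at_source: "?v i = s \<longleftrightarrow> i = D" if "i \<le> D" for i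
    using parent_chain_not_source[of t D i] parent_chain_source[of t D] t that by fastforce
  have "terminates (Loop ?b push_step) (40 * D + 10) ?Q N" if "I (40 * D + 10) N" for N
  proof (rule terminates_Loop[where I = I and B = 30])
    show "I (40 * D + 10) N" by fact
  next
    fix T N assume "I T N" and b: "bval ?b N"
    then obtain i where i: "i \<le> D" "T = 40 * (D - i) + 10" and N: "N vertex 0 = int (?v i)"
      "N stack_size 0 = int (length stk + i)" "\<forall>i'<length stk + i. N stack (int i') = ?stk ! i'"
      "N source = M source" "N parent = M parent" "N parent_eid = M parent_eid" by (auto simp: I_def)
    with b M at_source[of i] have vs: "?v i \<noteq> s" "i < D" by auto
    have "?v i < n \<and> d (?v i) = Suc D - i" using parent_chain[of t D i] t i by simp
    then have rd: "M parent (int (?v i)) = int (?v (Suc i))" "M parent_eid (int (?v i)) = int (pe (?v i))"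
      using rep vs by (auto simp: represents_def)
    show "terminates push_step 30 (\<lambda>M'. \<exists>T'. I T' M' \<and> bcost ?b + 30 + 1 + T' \<le> T) N"
    proof (rule terminates_run)
      let ?N = "run push_step N"
      have run: "?N vertex 0 = int (?v (Suc i))" "?N stack_size 0 = int (length stk + Suc i)"
        "?N stack = (N stack)(int (length stk + i) := int (pe (?v i)))"
        "?N source = M source" "?N parent = M parent" "?N parent_eid = M parent_eid"
        using rd by (simp_all add: push_step_def N del: funpow.simps)
      have "?stk ! (length stk + i) = int (pe (?v i))"
        using vs by (simp add: nth_append branches_def)
      then have "\<forall>i'<length stk + Suc i. ?N stack (int i') = ?stk ! i'"
        unfolding run using N(3) by (auto simp: less_Suc_eq)
      with run vs have "I (40 * (D - Suc i) + 10) ?N"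
        unfolding I_def by (intro exI[of _ "Suc i"] conjI) simp_all
      with i vs show "\<exists>T'. I T' ?N \<and> bcost ?b + 30 + 1 + T' \<le> T"
        by (intro exI conjI) auto
    qed (simp_all add: push_step_def)
  next
    fix T N assume "I T N" and b: "\<not> bval ?b N"
    then obtain i where i: "i \<le> D" "T = 40 * (D - i) + 10" and N: "N vertex 0 = int (?v i)"
      "N stack_size 0 = int (length stk + i)" "\<forall>i'<length stk + i. N stack (int i') = ?stk ! i'"
      "N source = M source" by (auto simp: I_def)
    with b M at_source[of i] have "i = D" by auto
    with N i show "bcost ?b + 1 \<le> T \<and> ?Q N" by simp
  qed
  moreover have "I (40 * D + 10) (run (vertex ::= Var sink) M)"
    unfolding I_def using M by (intro exI[of _ 0]) (auto simp: nth_append)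
  ultimately show "terminates push_path (40 * D + 20) ?Q M"
    unfolding push_path_def by (intro terminates_run_Seq[of _ _ "40 * D + 10"]) simp_all
qed

lemma pop_top:
  assumes "search_state k l s t X r (stk @ [x]) f M"
  shows "run pop_item M = M(stack_size := (M stack_size)(0 := int (length stk)), item := (M item)(0 := x))"
proof -
  have "M stack (int (length stk)) = x" using assms by (auto simp: search_state_def)
  with assms show ?thesis by (simp add: search_state_def pop_item_def)
qed

lemma visit_restore:
  assumes st: "search_state k l s t (insert e X) r (stk @ [- 1 - int e]) f M" and e: "e \<notin> X" "e \<le> m"
  shows "terminates visit 60 (search_state k l s t X (Suc r) stk f) M"
  unfolding visit_def
proof (intro terminates_run_Seq[of _ _ 40])
  let ?N = "run pop_item M"
  let ?M = "M(stack_size := (M stack_size)(0 := int (length stk)), item := (M item)(0 := - 1 - int e),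
    deleted := (M deleted)(int e := 0), budget := (M budget)(0 := int r + 1))"
  note N = pop_top[OF st]
  have "run restore_item ?N = ?M" using st unfolding N by (simp add: search_state_def restore_item_def)
  moreover have "search_state k l s t X (Suc r) stk f ?M"
    using st e by (auto simp: search_state_def tables_def nth_append)
  ultimately have "terminates restore_item 30 (search_state k l s t X (Suc r) stk f) ?N"
    by (intro terminates_run) (simp_all add: restore_item_def)
  then show "terminates (Cond (Less (Var item) (Const 0)) restore_item c) 40 (search_state k l s t X (Suc r) stk f) ?N" for c
    by (rule terminates_CondTrue[rotated]) (simp_all add: N)
qed (simp_all add: pop_item_def)

text \<open>All outcomes (disconnected, good, budget exhausted, branching) are expressed by one list
  \<open>bs\<close> of children, empty in the first three, so that the induction over the tree needs
  no case distinction. The truncated \<open>r - 1\<close> is harmless, since \<open>r = 0\<close>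
  forces \<open>bs = []\<close>.\<close>

lemma visit_delete:
  assumes st: "search_state k l s t X (Suc r) (stk @ [int e]) f M" and e: "e \<notin> X" "e \<le> m"
    and X: "X \<subseteq> {..m}" and st_lt: "s < n" "t < n"
  shows "terminates visit (170 * n + 200 * m + 300)
    (\<lambda>M'. \<exists>bs. set bs \<subseteq> {..<m} - insert e X \<and> (r = 0 \<longrightarrow> bs = []) \<and>
      sol l s t (insert e X) r = (good l s t (insert e X) \<or> (\<exists>b\<in>set bs. sol l s t (insert b (insert e X)) (r - 1))) \<and>
      1 + (\<Sum>b\<leftarrow>bs. nodes l s t (insert b (insert e X)) (r - 1)) \<le> nodes l s t (insert e X) r \<and>
      search_state k l s t (insert e X) r (stk @ [- 1 - int e] @ map int bs)
        (f \<or> good l s t (insert e X)) M') M"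
    (is "terminates visit ?T ?Q M")
  unfolding visit_def
proof (intro terminates_run_Seq[of _ _ "?T - 15"])
  let ?X = "insert e X" and ?stk = "stk @ [- 1 - int e]"
  let ?N = "run pop_item M"
  let ?D = "run delete_item ?N"
  note N = pop_top[OF st]
  have D: "?D = M(item := (M item)(0 := int e), deleted := (M deleted)(int e := 1), budget := (M budget)(0 := int r),
      stack := (M stack)(int (length stk) := - 1 - int e), stack_size := (M stack_size)(0 := int (length stk) + 1))"
    using st unfolding N by (simp add: search_state_def delete_item_def fun_upd_twist)
  have stD: "search_state k l s t ?X r ?stk f ?D"
    using st e unfolding D by (auto simp: search_state_def tables_def nth_append)
  have X': "?X \<subseteq> {..m}" using X e by simp
  have fin: "?Q M'" if "set bs \<subseteq> {..<m} - ?X" "r = 0 \<longrightarrow> bs = []"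
    "sol l s t ?X r = (good l s t ?X \<or> (\<exists>b\<in>set bs. sol l s t (insert b ?X) (r - 1)))"
    "1 + (\<Sum>b\<leftarrow>bs. nodes l s t (insert b ?X) (r - 1)) \<le> nodes l s t ?X r"
    "search_state k l s t ?X r (?stk @ map int bs) (f \<or> good l s t ?X) M'" for bs M'
    using that by (intro exI[of _ bs]) simp
  have nodes1: "1 \<le> nodes l s t ?X r"
    by (rule nodes_ge_1)
  have branch: "terminates branch (40 * n + 100) ?Q N"
    if bi: "bfs_inv ?X s qs (length qs) [] d p pe" and rep: "represents s N d p pe"
      and qt: "N queue_tail 0 = int (length qs)" and same: "\<forall>a. a \<notin> writes bfs \<longrightarrow> N a = ?D a"
    for N qs d p pe
  proof -
    \<comment> \<open>These are the arrays that \<open>search_state\<close> speaks of; the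
      breadth-first search writes none of them.\<close>
    have "N a = ?D a" if "a \<in> {0,1,2,3,4,5,6,7,14,15,16,17}" for a
      using same that
      by (auto simp: bfs_def bfs_init_def scan_def scan_step_def reset_step_def)
    then have stN: "search_state k l s t ?X r ?stk f N"
      using stD by (simp add: search_state_def tables_def)
    have conn: "bval (Equal (Var queue_tail) num_vertices) N \<longleftrightarrow> graph_connected {..<n} (live ?X)"
      using bfs_inv_connected[OF bi] qt stN by (simp add: search_state_def tables_def)
    show ?thesis
    proof (cases "graph_connected {..<n} (live ?X)")
      case False
      then have leaf: "leaf l s t ?X" "\<not> good l s t ?X" by (simp_all add: leaf_def good_def)
      have "?Q N" by (rule fin[of "[]"]) (use leaf sol_leaf[OF X'] nodes1 stN in simp_all)
      then have "terminates Skip 1 ?Q N" by (intro terminates_run) simp_all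
      then show ?thesis unfolding branch_def
        by (rule terminates_CondFalse[rotated]) (use conn False in \<open>simp_all del: One_nat_def\<close>)
    next
      case True
      interpret dl: dist_labels "{..<n}" "live ?X" s d p by (rule bfs_inv_final[OF bi])
      have "d t \<noteq> 0" using True st_lt unfolding dl.connected_iff by simp
      then obtain D where Dt: "d t = Suc D" using not0_implies_Suc by blast
      interpret br: branching n es ?X s d p pe t D
        by (rule bfs_inv_branching[OF bi X' st_lt(2) Dt])
      have dist: "graph_dist {..<n} (live ?X) s t = D" by (rule dl.dist_eq) (use st_lt Dt in auto)
      have good: "good l s t ?X \<longleftrightarrow> \<not> int D < l" using True by (auto simp: good_def dist)
      have leaf: "leaf l s t ?X \<longleftrightarrow> good l s t ?X" using True by (simp add: leaf_def)
      have short: "bval (Less (Sub (Read label (Var sink)) (Const 1)) input_l) N \<longleftrightarrow> int D < l"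
        using rep stN st_lt Dt by (simp add: search_state_def tables_def represents_def)
      have "terminates (Cond (Less (Sub (Read label (Var sink)) (Const 1)) input_l)
         (Cond (Less (Const 0) (Var budget)) push_path Skip)
         (answer_array ::= Const 1)) (40 * n + 80) ?Q N"
      proof (cases "int D < l")
        case False
        have "?Q (run (answer_array ::= Const 1) N)"
          by (rule fin[of "[]"])
            (use False good leaf sol_if_good[OF X'] nodes1 stN in \<open>simp_all add: search_state_def tables_def\<close>)
        then have "terminates (answer_array ::= Const 1) 10 ?Q N" by (intro terminates_run) simp_all
        then show ?thesis by (rule terminates_CondFalse[rotated]) (use short False in \<open>simp_all del: One_nat_def\<close>)
      next
        case short': True
        have bud: "bval (Less (Const 0) (Var budget)) N \<longleftrightarrow> 0 < r"
          using stN by (simp add: search_state_def)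
        have "terminates (Cond (Less (Const 0) (Var budget)) push_path Skip) (40 * n + 60) ?Q N"
        proof (cases r)
          case 0
          have "?Q N" by (rule fin[of "[]"])
            (use 0 short' good sol_0[OF X'] nodes1 stN in simp_all)
          then have "terminates Skip 1 ?Q N" by (intro terminates_run) simp_all
          then show ?thesis by (rule terminates_CondFalse[rotated]) (use bud 0 in \<open>simp_all del: One_nat_def\<close>)
        next
          case (Suc r')
          have nl: "\<not> leaf l s t ?X" using short' leaf good by simp
          have "terminates push_path (40 * D + 20) (\<lambda>M'.
            (M' stack_size 0 = int (length ?stk + D) \<and>
             (\<forall>i<length ?stk + D. M' stack (int i) = (?stk @ map int br.branches) ! i)) \<and>
            (\<forall>a. a \<notin> writes push_path \<longrightarrow> M' a = N a)) N"
            by (rule push_correct[OF br.branching_axioms rep])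
              (use stN in \<open>simp_all add: search_state_def\<close>)
          then have push: "terminates push_path (40 * D + 20) ?Q N"
          proof (rule terminates_mono)
            fix M'
            assume M': "(M' stack_size 0 = int (length ?stk + D) \<and>
             (\<forall>i<length ?stk + D. M' stack (int i) = (?stk @ map int br.branches) ! i)) \<and>
            (\<forall>a. a \<notin> writes push_path \<longrightarrow> M' a = N a)"
            have "M' a = N a" if "a \<in> {0,1,2,3,4,5,6,14,15,16}" for a
              using M' that by (auto simp: push_path_def push_step_def)
            with M' stN have "search_state k l s t ?X r (?stk @ map int br.branches) f M'"
              by (simp add: search_state_def tables_def br.length_branches)
            then show "?Q M'"
              by (intro fin[of br.branches])
                (use br.branches_subset Suc br.sol_branch[OF nl] br.nodes_branch[OF nl, of r'] short' good in simp_all)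
          qed simp
          \<comment> \<open>The label of a vertex is at most its position in the queue plus 1, and
            the queue has at most \<open>n\<close> entries.\<close>
          have "D \<le> n"
          proof -
            have "t \<in> set qs" using bi Dt st_lt by (auto simp: bfs_inv_def)
            then obtain i where "i < length qs" "qs ! i = t" by (auto simp: in_set_conv_nth)
            with bi Dt have "Suc D \<le> i + 1" by (auto simp: bfs_inv_def)
            with \<open>i < length qs\<close> bfs_inv_length[OF bi] show ?thesis by linarith
          qed
          with push show ?thesis
            by (intro terminates_CondTrue[of _ N _ "40 * D + 20"]) (use bud Suc in simp_all)
        qed
        then show ?thesis by (rule terminates_CondTrue[rotated]) (use short short' in \<open>simp_all del: One_nat_def\<close>)
      qed
      then show ?thesis unfolding branch_def
        by (rule terminates_CondTrue[rotated]) (use conn True in \<open>simp_all del: One_nat_def\<close>)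
    qed
  qed
  have "terminates bfs (130 * n + 200 * m + 100) (\<lambda>M'.
     (\<exists>qs d p pe. bfs_inv ?X s qs (length qs) [] d p pe \<and> represents s M' d p pe \<and>
       M' queue_tail 0 = int (length qs)) \<and> (\<forall>a. a \<notin> writes bfs \<longrightarrow> M' a = ?D a)) ?D"
    by (rule bfs_correct) (use stD st_lt in \<open>auto simp: search_state_def\<close>)
  then have "terminates (Seq bfs branch) (170 * n + 200 * m + 200) ?Q ?D"
    by (rule terminates_Seq[where ?T2.0 = "40 * n + 100"]) (use branch in blast, simp)
  then have "terminates (Seq delete_item (Seq bfs branch)) (170 * n + 200 * m + 260) ?Q ?N"
    by (rule terminates_run_Seq[rotated]) (simp_all add: delete_item_def)
  then show "terminates (Cond (Less (Var item) (Const 0)) restore_item (Seq delete_item (Seq bfs branch)))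
    (?T - 15) ?Q ?N"
    by (rule terminates_CondFalse[rotated]) (simp_all add: N)
qed (simp_all add: pop_item_def)

section \<open>The whole search tree of one pair\<close>

abbreviation (input) "unit_cost \<equiv> 170 * n + 200 * m + 400"

abbreviation (input) "search_iter \<equiv> iter (Less (Const 0) (Var stack_size)) visit"

lemma search_iter_visit:
  assumes "terminates visit T Q M" "search_state k l s t X r (stk @ [x]) f M"
  shows "\<exists>\<tau> M'. search_iter M \<tau> M' \<and> \<tau> \<le> T + 5 \<and> Q M'"
proof -
  from assms(1) obtain \<tau> M' where 1: "exec visit M \<tau> M'" "\<tau> \<le> T" "Q M'"
    unfolding terminates_def by blast
  have "bval (Less (Const 0) (Var stack_size)) M" using assms(2) by (simp add: search_state_def)
  from iter.step[OF this 1(1) iter.refl] 1(2,3) show ?thesis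
    by (intro exI[of _ "\<tau> + 5"] exI[of _ M']) (simp add: eval_nat_numeral)
qed

text \<open>Induction on the remaining budget. The item leaves a restoration marker with its
  children above it; each child is consumed by the induction hypothesis, for which the marker and
  the other children belong to an arbitrary lower stack, and then the marker undoes the deletion.
  The statement uses \<open>iter\<close> because the loop does not stop while items remain
  below.\<close>

lemma search_item:
  assumes "search_state k l s t X (Suc r) (stk @ [int e]) f M" "e \<notin> X" "e \<le> m"
    and "X \<subseteq> {..m}" and st_lt: "s < n" "t < n"
  shows "\<exists>\<tau> M'. search_iter M \<tau> M' \<and> \<tau> \<le> unit_cost * nodes l s t (insert e X) r \<and>
    search_state k l s t X (Suc r) stk (f \<or> sol l s t (insert e X) r) M'"
  using assms(1-4)
proof (induction r arbitrary: X stk e f M)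
  case (0 X stk e f M)
  have n1: "1 \<le> nodes l s t (insert e X) 0" by (rule nodes_ge_1)
  from search_iter_visit[OF visit_delete[OF 0 st_lt] 0(1)]
  obtain \<tau>1 M1 where 1: "search_iter M \<tau>1 M1" "\<tau>1 \<le> 170 * n + 200 * m + 305"
    "sol l s t (insert e X) 0 = good l s t (insert e X)"
    "search_state k l s t (insert e X) 0 (stk @ [- 1 - int e]) (f \<or> good l s t (insert e X)) M1"
    by auto
  from search_iter_visit[OF visit_restore[OF 1(4) 0(2,3)] 1(4)]
  obtain \<tau>2 M2 where 2: "search_iter M1 \<tau>2 M2" "\<tau>2 \<le> 65"
    "search_state k l s t X (Suc 0) stk (f \<or> sol l s t (insert e X) 0) M2"
    unfolding 1(3) by auto
  have "search_iter M (\<tau>1 + \<tau>2) M2" by (rule iter_trans) fact+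
  \<comment> \<open>A node pays for its deletion and for its later restoration:
    \<open>305 + 65\<close> stays within the 400 of \<open>unit_cost\<close>.\<close>
  moreover have "\<tau>1 + \<tau>2 \<le> unit_cost * 1" using 1 2 by simp
  moreover have "unit_cost * 1 \<le> unit_cost * nodes l s t (insert e X) 0" using n1 by (rule mult_le_mono2)
  ultimately show ?case using 2(3) by (meson le_trans)
next
  case (Suc r X stk e f M)
  let ?X = "insert e X" and ?stk = "stk @ [- 1 - int e]"
  have X': "?X \<subseteq> {..m}" using Suc.prems by simp
  from search_iter_visit[OF visit_delete[OF Suc.prems st_lt] Suc.prems(1), unfolded diff_Suc_1]
  obtain \<tau>1 M1 bs where 1: "search_iter M \<tau>1 M1" "\<tau>1 \<le> 170 * n + 200 * m + 300 + 5"
    "set bs \<subseteq> {..<m} - ?X"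
    "sol l s t ?X (Suc r) = (good l s t ?X \<or> (\<exists>b\<in>set bs. sol l s t (insert b ?X) r))"
    "1 + (\<Sum>b\<leftarrow>bs. nodes l s t (insert b ?X) r) \<le> nodes l s t ?X (Suc r)"
    "search_state k l s t ?X (Suc r) (stk @ [- 1 - int e] @ map int bs) (f \<or> good l s t ?X) M1"
    by blast
  \<comment> \<open>The last child is on top, hence the induction from the end of \<open>bs\<close>;
    the flag \<open>g\<close> is general because it collects the answers of the children already
    processed.\<close>
  have "\<exists>\<tau> M'. search_iter N \<tau> M' \<and> \<tau> \<le> unit_cost * (\<Sum>b\<leftarrow>bs. nodes l s t (insert b ?X) r) \<and>
      search_state k l s t ?X (Suc r) ?stk (g \<or> (\<exists>b\<in>set bs. sol l s t (insert b ?X) r)) M'"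
    if "search_state k l s t ?X (Suc r) (?stk @ map int bs) g N" "set bs \<subseteq> {..<m} - ?X" for bs g N
    using that
  proof (induction bs arbitrary: g N rule: rev_induct)
    case Nil
    then show ?case using iter.refl[of _ _ N] by fastforce
  next
    case (snoc b bs)
    have "search_state k l s t ?X (Suc r) ((?stk @ map int bs) @ [int b]) g N" "b \<notin> ?X" "b \<le> m"
      using snoc.prems by auto
    from Suc.IH[OF this X'] obtain \<tau>1 N1 where 1: "search_iter N \<tau>1 N1"
      "\<tau>1 \<le> unit_cost * nodes l s t (insert b ?X) r"
      "search_state k l s t ?X (Suc r) (?stk @ map int bs) (g \<or> sol l s t (insert b ?X) r) N1"
      by blast
    from snoc.IH[OF 1(3)] snoc.prems(2) obtain \<tau>2 N2 where 2: "search_iter N1 \<tau>2 N2"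
      "\<tau>2 \<le> unit_cost * (\<Sum>b\<leftarrow>bs. nodes l s t (insert b ?X) r)"
      "search_state k l s t ?X (Suc r) ?stk
        ((g \<or> sol l s t (insert b ?X) r) \<or> (\<exists>b\<in>set bs. sol l s t (insert b ?X) r)) N2"
      by auto
    have "search_iter N (\<tau>1 + \<tau>2) N2" by (rule iter_trans) fact+
    moreover have "\<tau>1 + \<tau>2 \<le> unit_cost * (\<Sum>b\<leftarrow>bs @ [b]. nodes l s t (insert b ?X) r)"
      using 1(2) 2(2) by (simp only: map_append sum_list.append distrib_left) simp
    moreover have "((g \<or> sol l s t (insert b ?X) r) \<or> (\<exists>b\<in>set bs. sol l s t (insert b ?X) r)) =
      (g \<or> (\<exists>b\<in>set (bs @ [b]). sol l s t (insert b ?X) r))" by auto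
    ultimately show ?case using 2(3) by auto
  qed
  from this[OF 1(6)[unfolded append_assoc[symmetric]] 1(3)] obtain \<tau>2 M2 where 2: "search_iter M1 \<tau>2 M2"
    "\<tau>2 \<le> unit_cost * (\<Sum>b\<leftarrow>bs. nodes l s t (insert b ?X) r)"
    "search_state k l s t ?X (Suc r) ?stk (f \<or> sol l s t ?X (Suc r)) M2"
    unfolding 1(4) by (auto simp: disj_assoc)
  from search_iter_visit[OF visit_restore[OF 2(3) Suc.prems(2,3)] 2(3)]
  obtain \<tau>3 M3 where 3: "search_iter M2 \<tau>3 M3" "\<tau>3 \<le> 65"
    "search_state k l s t X (Suc (Suc r)) stk (f \<or> sol l s t ?X (Suc r)) M3"
    by auto
  have "search_iter M (\<tau>1 + (\<tau>2 + \<tau>3)) M3" by (intro iter_trans[OF 1(1)] iter_trans[OF 2(1)]) fact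
  moreover have "\<tau>1 + (\<tau>2 + \<tau>3) \<le> unit_cost * (1 + (\<Sum>b\<leftarrow>bs. nodes l s t (insert b ?X) r))"
  proof -
    define W where "W = unit_cost * (\<Sum>b\<leftarrow>bs. nodes l s t (insert b ?X) r)"
    show ?thesis using 1(2) 2(2) 3(2) unfolding distrib_left mult_1_right W_def[symmetric] by linarith
  qed
  moreover have "\<dots> \<le> unit_cost * nodes l s t ?X (Suc r)" by (rule mult_le_mono2) (rule 1(5))
  ultimately show ?case using 3(3) by (meson le_trans)
qed

lemma search_correct:
  assumes st: "search_state k l s t {} (Suc r) [int m] f M" and st_lt: "s < n" "t < n"
  shows "terminates search (2 * unit_cost * nat (max 1 (l - 1)) ^ r + 5)
    (search_state k l s t {} (Suc r) [] (f \<or> sol l s t {m} r)) M"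
proof -
  have "search_state k l s t {} (Suc r) ([] @ [int m]) f M" using st by simp
  from search_item[OF this _ _ _ st_lt] obtain \<tau> M' where 1: "search_iter M \<tau> M'"
    "\<tau> \<le> unit_cost * nodes l s t {m} r"
    "search_state k l s t {} (Suc r) [] (f \<or> sol l s t {m} r) M'"
    by auto
  have "\<not> bval (Less (Const 0) (Var stack_size)) M'" using 1(3) by (simp add: search_state_def)
  from iter_Loop[OF 1(1) this] have "exec search M (\<tau> + 5) M'"
    by (simp add: search_def eval_nat_numeral)
  moreover have "unit_cost * nodes l s t {m} r \<le> unit_cost * (2 * nat (max 1 (l - 1)) ^ r)"
    by (rule mult_le_mono2) (rule nodes_le)
  then have "\<tau> + 5 \<le> 2 * unit_cost * nat (max 1 (l - 1)) ^ r + 5"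
    using 1(2) by (simp only: ac_simps)
  ultimately show ?thesis using 1(3) unfolding terminates_def by blast
qed

section \<open>All pairs of vertices\<close>

text \<open>The pair \<open>(s, t)\<close> has the number \<open>c = s * n + t\<close>.\<close>

definition pair_inv :: "int \<Rightarrow> int \<Rightarrow> nat \<Rightarrow> nat \<Rightarrow> nat \<Rightarrow> mem \<Rightarrow> bool" where
  "pair_inv k l B T c M \<longleftrightarrow> c \<le> n * n \<and> T = (B + 80) * (n * n - c) + 10 \<and>
     tables k l M \<and> (\<forall>i\<le>m. M deleted (int i) = 0) \<and>
     M source 0 = int (c div n) \<and> M sink 0 = int (c mod n) \<and>
     M answer_array 0 = (if \<exists>c'<c. sol l (c' div n) (c' mod n) {m} (nat k) then 1 else 0)"

text \<open>Every search ends with the deletion set \<open>{}\<close> again, so the pairs do not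
  influence each other and their times add up.\<close>

lemma pairs_correct:
  assumes k: "0 \<le> k" and M: "tables k l M" "\<forall>a\<in>{answer_array, deleted, source, sink}. M a = (\<lambda>_. 0)"
  defines "B \<equiv> 2 * unit_cost * nat (max 1 (l - 1)) ^ nat k + 5"
  shows "terminates (Loop (Less (Var source) num_vertices) pair_step) ((B + 80) * (n * n) + 10)
    (\<lambda>N. N answer_array 0 = (if \<exists>s<n. \<exists>t<n. sol l s t {m} (nat k) then 1 else 0)) M"
proof (rule terminates_Loop[where I = "\<lambda>T N. \<exists>c. pair_inv k l B T c N" and B = "B + 60"])
  let ?b = "Less (Var source) num_vertices"
  show "\<exists>c. pair_inv k l B ((B + 80) * (n * n) + 10) c M"
    using M by (intro exI[of _ 0]) (simp add: pair_inv_def)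
  fix T N assume "\<exists>c. pair_inv k l B T c N"
  then obtain c where c: "c \<le> n * n" "T = (B + 80) * (n * n - c) + 10" and N: "tables k l N"
      "\<forall>i\<le>m. N deleted (int i) = 0" "N source 0 = int (c div n)" "N sink 0 = int (c mod n)"
      "N answer_array 0 = (if \<exists>c'<c. sol l (c' div n) (c' mod n) {m} (nat k) then 1 else 0)"
    unfolding pair_inv_def by blast
  have n: "N 0 0 = int n" using N by (simp add: tables_def)
  {
    assume "bval ?b N"
    then have s: "c div n < n" using N n by simp
    then have cn: "c < n * n" by (simp add: div_less_iff_less_mult n_pos)
    have t: "c mod n < n" using n_pos by simp
    let ?f = "\<exists>c'<c. sol l (c' div n) (c' mod n) {m} (nat k)"
    let ?f' = "\<exists>c'<Suc c. sol l (c' div n) (c' mod n) {m} (nat k)"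
    let ?push = "\<lambda>c'. budget ::= Succ input_k;; Write stack (Const 0) num_edges;; stack_size ::= Const 1;; c'"
    let ?fin = "sink ::= Succ (Var sink);;
        Cond (Equal (Var sink) num_vertices) (sink ::= Const 0;; source ::= Succ (Var source)) Skip"
    let ?N = "N(budget := (N budget)(0 := k + 1), stack := (N stack)(0 := int m), stack_size := (N stack_size)(0 := 1))"
    have f': "?f' \<longleftrightarrow> ?f \<or> sol l (c div n) (c mod n) {m} (nat k)" by (auto simp: less_Suc_eq)
    have "search_state k l (c div n) (c mod n) {} (Suc (nat k)) [int m] ?f ?N"
      using N k by (simp add: search_state_def tables_def)
    from search_correct[OF this s t]
    have 1: "terminates search B (search_state k l (c div n) (c mod n) {} (Suc (nat k)) [] ?f') ?N"
      unfolding f' B_def .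
    let ?R = "\<lambda>M'. \<exists>T'. (\<exists>c. pair_inv k l B T' c M') \<and> bcost ?b + (B + 60) + 1 + T' \<le> T"
    have 2: "terminates ?fin 30 ?R N'"
      if N': "search_state k l (c div n) (c mod n) {} (Suc (nat k)) [] ?f' N'" for N'
    proof (rule terminates_run)
      have "pair_inv k l B ((B + 80) * (n * n - Suc c) + 10) (Suc c) (run ?fin N')"
        \<comment> \<open>The wrap-around of \<open>sink\<close> and the increment of
          \<open>source\<close> are the successor rules for \<open>mod\<close> and
          \<open>div\<close>.\<close>
        using N' cn n_pos unfolding pair_inv_def
        by (auto simp: search_state_def tables_def div_Suc mod_Suc)
      moreover have "n * n - c = Suc (n * n - Suc c)" using cn by simp
      then have "bcost ?b + (B + 60) + 1 + ((B + 80) * (n * n - Suc c) + 10) \<le> T"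
        unfolding c by simp
      ultimately show "?R (run ?fin N')" by blast
    qed simp_all
    have 3: "terminates (Seq search ?fin) (B + 30) ?R ?N"
      by (rule terminates_Seq[OF 1 2]) simp_all
    have "terminates (Seq search ?fin) (B + 30) ?R (run (stack_size ::= Const 1)
        (run (Write stack (Const 0) num_edges) (run (budget ::= Succ input_k) N)))"
      using 3 N by (simp add: tables_def)
    from terminates_run_Seq[OF _ terminates_run_Seq[OF _ terminates_run_Seq[OF _ this order_refl] order_refl]]
    show "terminates pair_step (B + 60) ?R N"
      unfolding pair_step_def by simp
  next
    assume "\<not> bval ?b N"
    then have "n \<le> c div n" using N n by simp
    with c n_pos have cn: "c = n * n"
      by (metis div_less_iff_less_mult le_neq_implies_less not_le)
    have "(\<exists>c'<n * n. sol l (c' div n) (c' mod n) {m} (nat k)) \<longleftrightarrow> (\<exists>s<n. \<exists>t<n. sol l s t {m} (nat k))"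
    proof
      assume "\<exists>c'<n * n. sol l (c' div n) (c' mod n) {m} (nat k)"
      then show "\<exists>s<n. \<exists>t<n. sol l s t {m} (nat k)"
        using n_pos by (metis div_less_iff_less_mult mod_less_divisor)
    next
      assume "\<exists>s<n. \<exists>t<n. sol l s t {m} (nat k)"
      then obtain s t where st: "s < n" "t < n" "sol l s t {m} (nat k)" by blast
      have "s * n + t < Suc s * n" using st by simp
      also have "\<dots> \<le> n * n" using st by (intro mult_le_mono1) simp
      finally show "\<exists>c'<n * n. sol l (c' div n) (c' mod n) {m} (nat k)"
        using st by (intro exI[of _ "s * n + t"]) simp
    qed
    with c N cn show "bcost ?b + 1 \<le> T \<and>
      N answer_array 0 = (if \<exists>s<n. \<exists>t<n. sol l s t {m} (nat k) then 1 else 0)" by simp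
  }
qed

lemma decide_correct:
  "terminates decide (2000 * time_bound n m k l)
    (\<lambda>M. answer M = (if MDED {..<n} (live {}) k l then 1 else 0)) (load (encode n es k l))"
proof -
  let ?L = "load (encode n es k l)" and ?Q = "\<lambda>M. answer M = (if MDED {..<n} (live {}) k l then 1 else 0)"
  let ?loop = "Loop (Less (Var source) num_vertices) pair_step"
  define P where "P = nat (max 1 (l - 1)) ^ nat k"
  let ?T = "2 * unit_cost * P + 5"
  have P: "1 \<le> P" by (simp add: P_def)
  have "terminates (Cond (Less input_k (Const 0)) Skip ?loop) ((?T + 80) * (n * n) + 20) ?Q M"
    if M: "tables k l M \<and> (\<forall>a. a \<notin> writes build \<longrightarrow> M a = ?L a)" for M
  proof -
    have zero: "\<forall>a\<in>{answer_array, deleted, source, sink}. M a = (\<lambda>_. 0)"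
      using M load_encode(7) by (simp add: build_def build_step_def)
    have b: "bval (Less input_k (Const 0)) M \<longleftrightarrow> k < 0" using M by (simp add: tables_def)
    show ?thesis
    proof (cases "k < 0")
      case True
      then have "\<not> MDED {..<n} (live {}) k l" by (auto simp: MDED_def)
      with zero have "terminates Skip 1 ?Q M" by (intro terminates_run) (simp_all add: answer_def)
      then show ?thesis
        by (rule terminates_CondTrue[rotated]) (use b True in \<open>simp_all del: One_nat_def\<close>)
    next
      case False
      with pairs_correct[of k l M] M zero MDED_iff_sol[of k l]
      have "terminates ?loop ((?T + 80) * (n * n) + 10) ?Q M"
        by (simp add: answer_def P_def)
      then show ?thesis
        by (rule terminates_CondFalse[rotated]) (use b False in \<open>simp_all del: One_nat_def\<close>)
    qed
  qed
  then have "terminates decide (110 * m + 20 + ((?T + 80) * (n * n) + 20)) ?Q ?L"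
    unfolding decide_def by (rule terminates_Seq[OF build_correct]) simp_all
  \<comment> \<open>As \<open>P\<close> and \<open>n\<close> are at least 1, each of
    \<open>n + m\<close>, \<open>n ^ 2\<close> and 1 is at most the product \<open>?Z\<close>. The
    600 combines the 200 per vertex or edge with the additive 400 of \<open>unit_cost\<close>;
    altogether \<open>110 + 40 + 85 + 2 * 600\<close> is below 2000.\<close>
  moreover have "110 * m + 20 + ((?T + 80) * (n * n) + 20) \<le> 2000 * (P * n ^ 2 * (n + m))"
  proof -
    let ?Z = "P * n ^ 2 * (n + m)"
    have n2: "1 \<le> n ^ 2" "1 \<le> n + m" using n_pos by (simp_all add: Suc_le_eq)
    have "n + m \<le> ?Z" using mult_le_mono[OF mult_le_mono[OF P n2(1)] order_refl[of "n + m"]] by simp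
    moreover have "n ^ 2 \<le> ?Z" using mult_le_mono[OF mult_le_mono[OF P order_refl[of "n ^ 2"]] n2(2)] by simp
    moreover have "unit_cost * (P * n ^ 2) \<le> 600 * (n + m) * (P * n ^ 2)"
      by (rule mult_le_mono1) (use n2 in simp)
    then have "unit_cost * (P * n ^ 2) \<le> 600 * ?Z" by (simp only: ac_simps)
    moreover have "110 * m + 20 + ((?T + 80) * (n * n) + 20) = 110 * m + 40 + 85 * n ^ 2 + 2 * (unit_cost * (P * n ^ 2))"
      by (simp add: algebra_simps power2_eq_square)
    ultimately show ?thesis using n2 by linarith
  qed
  ultimately show ?thesis
    unfolding time_bound_def P_def by (rule terminates_mono)
qed

end

theorem theorem17:
  "\<exists>(p :: com) (C :: nat).
     \<forall>(n :: nat) (E :: nat set set) (es :: (nat \<times> nat) list) (k :: int) (l :: int).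
       simple_graph {..<n} E \<and> graph_connected {..<n} E \<and> lists_edges es E \<longrightarrow>
       (\<exists>t M. exec p (load (encode n es k l)) t M \<and>
              answer M = (if MDED {..<n} E k l then 1 else 0) \<and>
              t \<le> C * time_bound n (card E) k l)"
proof (rule exI[of _ decide], rule exI[of _ 2000], intro allI impI)
  fix n :: nat and E :: "nat set set" and es :: "(nat \<times> nat) list" and k l :: int
  assume asm: "simple_graph {..<n} E \<and> graph_connected {..<n} E \<and> lists_edges es E"
  then have dist: "distinct (map (\<lambda>(u, v). {u, v}) es)" and E: "E = set (map (\<lambda>(u, v). {u, v}) es)"
    by (simp_all add: lists_edges_def)
  interpret edge_list n es
  proof
    show "0 < n" using asm by (auto simp: graph_connected_def)
    fix u v assume "(u, v) \<in> set es"
    then have "{u, v} \<in> E" unfolding E by force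
    with asm have "{u, v} \<subseteq> {..<n}" "card {u, v} = 2" by (auto simp: simple_graph_def)
    then show "u < n \<and> v < n \<and> u \<noteq> v" by (cases "u = v") auto
  qed (rule dist)
  have "card E = m" unfolding E using distinct_card[OF dist] by (simp add: m_def)
  moreover have "live {} = E"
  proof -
    have "set es = (!) es ` {..<m}" by (auto simp: set_conv_nth m_def)
    then show ?thesis unfolding E by (simp add: live_def edge_def image_image case_prod_beta)
  qed
  ultimately show "\<exists>t M. exec decide (load (encode n es k l)) t M \<and>
              answer M = (if MDED {..<n} E k l then 1 else 0) \<and>
              t \<le> 2000 * time_bound n (card E) k l"
    using decide_correct[of k l] unfolding terminates_def by metis
qed

end
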